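(* Let $\{(N_n,B_n,L_n)\}_{n\ge 1}$ be a sequence of Hadamard triples with $B_n\subset\{0,1,\dots,N_n-1\}$ for all $n\ge 1$. Suppose that $\liminf_{n\to\infty}\#B_n<\infty$. Then the associated Cantor-Moran measure $$\mu=\mu(N_n,B_n)=\delta_{\frac{1}{N_1}B_1}\ast\delta_{\frac{1}{N_1N_2}B_2}\ast\delta_{\frac{1}{N_1N_2N_3}B_3}\ast\cdots$$ is a spectral measure, and it admits a spectrum $\Lambda\subset\mathbb{Z}$.
   Context: A Hadamard triple $(N,B,L)$ consists of an integer $N\ge 2$ and finite sets $B,L\subset\mathbb{Z}$ with $\#B=\#L=M\le N$ such that the matrix $H=\frac{1}{\sqrt M}\left[e^{-2\pi i bl/N}\right]_{b\in B,\,l\in L}$ is unitary. For a finite nonempty set $A\subset\mathbb{R}$, $\delta_A=\frac{1}{\#A}\sum_{a\in A}\delta_a$, where $\delta_a$ is the Dirac measure at $a$. The infinite convolution is the weak limit of the finite convolutions; it is a Borel probability measure supported in $[0,1]$. A Borel probability measure $\mu$ on $\mathbb{R}$ is a spectral measure if there is a countable set $\Lambda\subset\mathbb{R}$ (called a spectrum) such that $\{e^{2\pi i\lambda x}:\lambda\in\Lambda\}$ is an orthonormal basis of $L^2(\mu)$. *)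

theory Defs
  imports "HOL-Probability.Probability" "HOL-Library.Extended_Nat"
begin

section \<open>Hadamard triples\<close>

text \<open>Matrices are indexed by arbitrary finite sets: rows by \<open>R\<close>, columns by \<open>C\<close>. Only the
  values \<open>H r c\<close> with \<open>r \<in> R\<close> and \<open>c \<in> C\<close> matter.\<close>

definition unitary_on :: "'r set \<Rightarrow> 'c set \<Rightarrow> ('r \<Rightarrow> 'c \<Rightarrow> complex) \<Rightarrow> bool" where
  "unitary_on R C H \<longleftrightarrow>
     (\<forall>r\<in>R. \<forall>r'\<in>R. (\<Sum>c\<in>C. H r c * cnj (H r' c)) = (if r = r' then 1 else 0)) \<and>
     (\<forall>c\<in>C. \<forall>c'\<in>C. (\<Sum>r\<in>R. cnj (H r c) * H r c') = (if c = c' then 1 else 0))"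

definition hadamard_matrix :: "nat \<Rightarrow> int set \<Rightarrow> int \<Rightarrow> int \<Rightarrow> complex" where
  "hadamard_matrix N B b l =
     1 / of_real (sqrt (real (card B))) * exp (- 2 * of_real pi * \<i> * of_int b * of_int l / of_nat N)"

text \<open>The normalisation \<open>1 / sqrt M\<close> presupposes \<open>M \<noteq> 0\<close>, hence \<open>B \<noteq> {}\<close>.\<close>

definition hadamard_triple :: "nat \<Rightarrow> int set \<Rightarrow> int set \<Rightarrow> bool" where
  "hadamard_triple N B L \<longleftrightarrow>
     N \<ge> 2 \<and> finite B \<and> finite L \<and> B \<noteq> {} \<and> card B = card L \<and> card B \<le> N \<and>
     unitary_on B L (hadamard_matrix N B)"


section \<open>Infinite convolutions and Cantor-Moran measures\<close>

text \<open>The measure \<open>\<delta>\<^sub>A\<close>, as a Borel measure on the real line.\<close>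

definition uniform_dirac :: "real set \<Rightarrow> real measure" where
  "uniform_dirac A = distr (uniform_count_measure A) borel (\<lambda>x. x)"

lemma emeasure_uniform_dirac:
  assumes "finite A" "A \<noteq> {}" "S \<in> sets borel"
  shows "emeasure (uniform_dirac A) S
           = ennreal (1 / real (card A)) * (\<Sum>a\<in>A. emeasure (return borel a) S)"
proof -
  have "emeasure (uniform_dirac A) S = emeasure (uniform_count_measure A) (S \<inter> A)"
    unfolding uniform_dirac_def using assms
    by (subst emeasure_distr)
       (auto simp: measurable_def sets_uniform_count_measure space_uniform_count_measure)
  also have "\<dots> = ennreal (real (card (S \<inter> A)) / real (card A))"
    using assms by (subst emeasure_uniform_count_measure) auto
  also have "\<dots> = ennreal (1 / real (card A)) * ennreal (real (card (S \<inter> A)))"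
    by (subst ennreal_mult[symmetric]) auto
  also have "ennreal (real (card (S \<inter> A))) = (\<Sum>a\<in>A. indicator S a)"
    using assms
    by (simp add: indicator_def sum.If_cases ennreal_of_nat_eq_real_of_nat Int_commute)
  also have "(\<Sum>a\<in>A. indicator S a :: ennreal) = (\<Sum>a\<in>A. emeasure (return borel a) S)"
    using assms by simp
  finally show ?thesis .
qed

lemma real_distribution_uniform_dirac:
  assumes "finite A" "A \<noteq> {}"
  shows "real_distribution (uniform_dirac A)"
proof -
  interpret prob_space "uniform_count_measure A"
    using assms by (rule prob_space_uniform_count_measure)
  have "prob_space (uniform_dirac A)"
    unfolding uniform_dirac_def
    by (rule prob_space_distr)
       (auto simp: measurable_def sets_uniform_count_measure space_uniform_count_measure)
  then show ?thesis
    by (simp add: real_distribution_def real_distribution_axioms_def uniform_dirac_def)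
qed

text \<open>\<open>\<nu> 1 \<star> \<dots> \<star> \<nu> n\<close>; the value at \<open>0\<close> is the neutral element of convolution, and
  \<open>\<nu> 0\<close> is not used.\<close>

primrec finite_convolution :: "(nat \<Rightarrow> real measure) \<Rightarrow> nat \<Rightarrow> real measure" where
  "finite_convolution \<nu> 0 = return borel 0"
| "finite_convolution \<nu> (Suc n) = (finite_convolution \<nu> n \<star> \<nu> (Suc n))"

definition infinite_convolution :: "(nat \<Rightarrow> real measure) \<Rightarrow> real measure" where
  "infinite_convolution \<nu> =
     (THE \<mu>. real_distribution \<mu> \<and> weak_conv_m (finite_convolution \<nu>) \<mu>)"

lemma real_distribution_finite_convolution:
  assumes "\<And>k. k \<ge> 1 \<Longrightarrow> real_distribution (\<nu> k)"
  shows "real_distribution (finite_convolution \<nu> n)"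
proof (induction n)
  case 0
  show ?case
    by (simp add: real_distribution_def real_distribution_axioms_def prob_space_return)
next
  case (Suc n)
  interpret A: real_distribution "finite_convolution \<nu> n" by (fact Suc)
  interpret B: real_distribution "\<nu> (Suc n)" using assms by simp
  interpret pair_prob_space "finite_convolution \<nu> n" "\<nu> (Suc n)" ..
  have "prob_space (finite_convolution \<nu> n \<star> \<nu> (Suc n))"
    unfolding convolution_def by (rule prob_space_distr) measurable
  then show ?case
    by (simp add: real_distribution_def real_distribution_axioms_def)
qed

text \<open>Weak limits are unique, so the description above denotes the weak limit whenever there is
  one.\<close>

lemma infinite_convolution_eqI:
  assumes \<nu>: "\<And>k. k \<ge> 1 \<Longrightarrow> real_distribution (\<nu> k)"
    and \<mu>: "real_distribution \<mu>" "weak_conv_m (finite_convolution \<nu>) \<mu>"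
  shows "infinite_convolution \<nu> = \<mu>"
  unfolding infinite_convolution_def
proof (rule the_equality)
  fix \<mu>' assume \<mu>': "real_distribution \<mu>' \<and> weak_conv_m (finite_convolution \<nu>) \<mu>'"
  have fc: "real_distribution (finite_convolution \<nu> n)" for n
    using \<nu> by (rule real_distribution_finite_convolution)
  have lim: "(\<lambda>n. char (finite_convolution \<nu> n) t) \<longlonglongrightarrow> char M t"
    if "real_distribution M" "weak_conv_m (finite_convolution \<nu>) M" for M t
    using fc that by (rule levy_continuity1)
  have "char \<mu>' t = char \<mu> t" for t
    using lim[of \<mu>' t] lim[of \<mu> t] \<mu> \<mu>' by (intro LIMSEQ_unique) auto
  then have "char \<mu>' = char \<mu>" by blast
  with \<mu> \<mu>' show "\<mu>' = \<mu>" by (intro Levy_uniqueness) auto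
qed (use \<mu> in simp)

text \<open>The \<open>n\<close>-th factor is \<open>\<delta>\<close> of \<open>B\<^sub>n / (N\<^sub>1 \<cdots> N\<^sub>n)\<close>, for \<open>n \<ge> 1\<close>.\<close>

definition cantor_moran_measure :: "(nat \<Rightarrow> nat) \<Rightarrow> (nat \<Rightarrow> int set) \<Rightarrow> real measure" where
  "cantor_moran_measure N B =
     infinite_convolution
       (\<lambda>n. uniform_dirac ((\<lambda>b. real_of_int b / real (\<Prod>k=1..n. N k)) ` B n))"


section \<open>Spectral measures\<close>

definition L2_functions :: "'a measure \<Rightarrow> ('a \<Rightarrow> complex) set" where
  "L2_functions M = {f \<in> borel_measurable M. integrable M (\<lambda>x. (cmod (f x))\<^sup>2)}"

definition L2_inner :: "'a measure \<Rightarrow> ('a \<Rightarrow> complex) \<Rightarrow> ('a \<Rightarrow> complex) \<Rightarrow> complex" where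
  "L2_inner M f g = (\<integral>x. f x * cnj (g x) \<partial>M)"

text \<open>An orthonormal basis is an orthonormal family whose finite linear combinations are dense
  in \<open>L\<^sup>2(M)\<close>. Elements of \<open>L\<^sup>2(M)\<close> are represented by functions.\<close>

definition L2_orthonormal_basis :: "'a measure \<Rightarrow> 'i set \<Rightarrow> ('i \<Rightarrow> 'a \<Rightarrow> complex) \<Rightarrow> bool" where
  "L2_orthonormal_basis M I e \<longleftrightarrow>
     (\<forall>i\<in>I. e i \<in> L2_functions M) \<and>
     (\<forall>i\<in>I. \<forall>j\<in>I. L2_inner M (e i) (e j) = (if i = j then 1 else 0)) \<and>
     (\<forall>f\<in>L2_functions M. \<forall>\<epsilon>>0. \<exists>F c. finite F \<and> F \<subseteq> I \<and>
        sqrt (\<integral>x. (cmod (f x - (\<Sum>i\<in>F. c i * e i x)))\<^sup>2 \<partial>M) < \<epsilon>)"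

definition is_spectrum :: "real measure \<Rightarrow> real set \<Rightarrow> bool" where
  "is_spectrum \<mu> \<Lambda> \<longleftrightarrow> countable \<Lambda> \<and>
     L2_orthonormal_basis \<mu> \<Lambda> (\<lambda>l x. exp (2 * of_real pi * \<i> * of_real l * of_real x))"

definition spectral_measure :: "real measure \<Rightarrow> bool" where
  "spectral_measure \<mu> \<longleftrightarrow> real_distribution \<mu> \<and> (\<exists>\<Lambda>. is_spectrum \<mu> \<Lambda>)"

end

theory Submission
  imports Defs
begin

text \<open>
  A probability measure \<open>\<rho>\<close> on \<open>[0, 1]\<close> satisfies \<open>\<bar>\<rho>^(\<xi>)\<bar> \<ge> cos (\<pi> \<xi>)\<close> for \<open>\<bar>\<xi>\<bar> < 1 / 2\<close>, and its Fourier
  transform is Lipschitz with constant \<open>2 \<pi>\<close>. The rescaled tails \<open>\<nu>\<^sub>n\<close> of the convolution are such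
  measures, and \<open>\<nu>\<^sub>n^(\<xi>) = m\<^sub>B(\<xi> / N) \<nu>\<^sub>n\<^sub>+\<^sub>1^(\<xi> / N)\<close> with \<open>B = B\<^sub>n\<^sub>+\<^sub>1\<close>, \<open>N = N\<^sub>n\<^sub>+\<^sub>1\<close> and \<open>m\<^sub>B\<close> the Fourier
  transform of \<open>\<delta>\<^sub>B\<close>. If \<open>#B \<le> m\<close>, then every coset \<open>x + \<int>\<close> contains a point at which \<open>\<bar>\<nu>\<^sub>n^\<bar>\<close> is at
  least a constant depending only on \<open>m\<close>: for \<open>N < 4 m\<close> take the point in \<open>[- 1/2, 1/2]\<close>; for
  \<open>N \<ge> 4 m\<close> the Hadamard property gives a point where \<open>\<bar>m\<^sub>B\<bar>\<close> is large, and Turan's inequality moves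
  it along an arithmetic progression until \<open>\<xi> / N\<close> stays away from \<open>\<plusminus> 1/2\<close>, where the cosine bound
  applies to \<open>\<nu>\<^sub>n\<^sub>+\<^sub>1\<close>.

  Spectra of the finite convolutions may be translated elementwise by multiples of \<open>N\<^sub>1 \<cdots> N\<^sub>n\<close>. At
  the infinitely many levels with \<open>#B\<^sub>n\<^sub>+\<^sub>1 \<le> m\<close> one uses this freedom to make the tail bounded below on
  an increasing sequence of integer spectra. Their union is orthogonal, and the lower bound dominates
  the Parseval sums, which therefore converge to \<open>1\<close>.
\<close>

section \<open>Fourier transforms of Cantor-Moran measures\<close>

text \<open>The exponent has the sign of \<open>char\<close>, opposite to
  \<open>hadamard_matrix\<close>, and frequencies are measured in units of \<open>2 * pi\<close>, so
  that integer digits give period 1.\<close>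

definition mask_poly :: "int set \<Rightarrow> real \<Rightarrow> complex" where
  "mask_poly B \<eta> = (\<Sum>b\<in>B. cis (2 * pi * (\<eta> * of_int b))) / of_nat (card B)"

definition base_prod :: "(nat \<Rightarrow> nat) \<Rightarrow> nat \<Rightarrow> nat" where
  "base_prod N n = (\<Prod>k=1..n. N k)"

text \<open>The Fourier transform of the convolution of the first \<open>n\<close> factors; see
  \<open>char_fconv\<close>.\<close>

definition mask_poly_prod :: "(nat \<Rightarrow> nat) \<Rightarrow> (nat \<Rightarrow> int set) \<Rightarrow> nat \<Rightarrow> real \<Rightarrow> complex" where
  "mask_poly_prod N B n \<xi> = (\<Prod>k=1..n. mask_poly (B k) (\<xi> / base_prod N k))"

lemma base_prod_0 [simp]: "base_prod N 0 = 1"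
  and base_prod_Suc [simp]: "base_prod N (Suc n) = base_prod N n * N (Suc n)"
  by (simp_all add: base_prod_def)

lemma mask_poly_prod_0 [simp]: "mask_poly_prod N B 0 \<xi> = 1"
  and mask_poly_prod_Suc [simp]:
    "mask_poly_prod N B (Suc n) \<xi> = mask_poly_prod N B n \<xi> * mask_poly (B (Suc n)) (\<xi> / base_prod N (Suc n))"
  by (simp_all add: mask_poly_prod_def)

lemma norm_cis_diff_le: "cmod (cis a - cis b) \<le> \<bar>a - b\<bar>"
proof -
  have "cmod (cis a - cis b) = cmod (cis b * (cis (a - b) - 1))"
    by (simp add: algebra_simps cis_mult)
  also have "\<dots> = cmod (iexp (a - b) - 1)"
    by (simp add: norm_mult cis_conv_exp)
  also have "\<dots> \<le> \<bar>a - b\<bar>"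
    using iexp_approx1[of "a - b" 0] by simp
  finally show ?thesis .
qed

lemma norm_mask_poly_le_1: "cmod (mask_poly B \<eta>) \<le> 1"
proof (cases "card B = 0")
  case False
  have "cmod (\<Sum>b\<in>B. cis (2 * pi * (\<eta> * of_int b))) \<le> (\<Sum>b\<in>B. 1)"
    by (rule sum_norm_le) simp
  with False show ?thesis
    by (simp add: mask_poly_def norm_divide)
qed (simp add: mask_poly_def)

lemma mask_poly_0 [simp]: "finite B \<Longrightarrow> B \<noteq> {} \<Longrightarrow> mask_poly B 0 = 1"
  by (simp add: mask_poly_def)

text \<open>Digits below \<open>N\<close> keep every phase below the stated bound. At
  \<open>\<eta> = \<xi> / base_prod N (Suc n)\<close> with base \<open>N (Suc n)\<close> the base
  cancels, which leaves a multiple of \<open>1 / base_prod N n\<close>; this makes the infinite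
  product converge.\<close>

lemma norm_mask_poly_minus_1_le:
  assumes "finite B" "B \<noteq> {}" "B \<subseteq> {0..int N - 1}"
  shows "cmod (mask_poly B \<eta> - 1) \<le> 2 * pi * \<bar>\<eta>\<bar> * real N"
proof -
  have "mask_poly B \<eta> - 1 = (\<Sum>b\<in>B. cis (2 * pi * (\<eta> * of_int b)) - 1) / of_nat (card B)"
    using assms by (simp add: mask_poly_def sum_subtractf diff_divide_distrib)
  moreover have "cmod (\<Sum>b\<in>B. cis (2 * pi * (\<eta> * of_int b)) - 1) \<le> (\<Sum>b\<in>B. 2 * pi * \<bar>\<eta>\<bar> * real N)"
  proof (rule sum_norm_le)
    fix b assume "b \<in> B"
    then have b: "0 \<le> b" "b \<le> int N" using assms by auto
    have "cmod (cis (2 * pi * (\<eta> * of_int b)) - cis 0) \<le> \<bar>2 * pi * (\<eta> * of_int b) - 0\<bar>"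
      by (rule norm_cis_diff_le)
    also have "\<dots> = 2 * pi * \<bar>\<eta>\<bar> * of_int b"
      using b by (simp add: abs_mult)
    also have "\<dots> \<le> 2 * pi * \<bar>\<eta>\<bar> * real N"
      using b by (intro mult_left_mono) auto
    finally show "cmod (cis (2 * pi * (\<eta> * of_int b)) - 1) \<le> 2 * pi * \<bar>\<eta>\<bar> * real N"
      by simp
  qed
  ultimately show ?thesis
    using assms by (simp only: norm_divide) (simp add: divide_le_eq mult_ac card_gt_0_iff)
qed

lemma mask_poly_add_int: "mask_poly B (\<eta> + of_int k) = mask_poly B \<eta>"
proof -
  have "cis (2 * pi * ((\<eta> + of_int k) * of_int b)) = cis (2 * pi * (\<eta> * of_int b))" for b
  proof -
    have "cis (2 * pi * ((\<eta> + of_int k) * of_int b))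
        = cis (2 * pi * (\<eta> * of_int b)) * cis (2 * pi * of_int (k * b))"
      by (simp add: cis_mult algebra_simps)
    also have "cis (2 * pi * of_int (k * b)) = 1"
      by (rule cis_multiple_2pi) simp
    finally show ?thesis by simp
  qed
  then show ?thesis by (simp add: mask_poly_def)
qed

section \<open>Characteristic functions and supports under convolution and weak limits\<close>

lemma char_uniform_dirac:
  assumes "finite A"
  shows "char (uniform_dirac A) t = (\<Sum>a\<in>A. cis (t * a)) / of_nat (card A)"
proof -
  have "char (uniform_dirac A) t = (\<integral>x. iexp (t * x) \<partial>uniform_count_measure A)"
    unfolding char_def uniform_dirac_def
    by (rule integral_distr)
       (simp add: measurable_def sets_uniform_count_measure space_uniform_count_measure, measurable)
  also have "\<dots> = (\<Sum>a\<in>A. (1 / real (card A)) *\<^sub>R iexp (t * a))"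
    unfolding uniform_count_measure_def
    using assms by (subst lebesgue_integral_point_measure_finite) simp_all
  also have "\<dots> = (\<Sum>a\<in>A. cis (t * a)) / of_nat (card A)"
    by (simp add: sum_divide_distrib cis_conv_exp scaleR_conv_of_real)
  finally show ?thesis .
qed

lemma AE_uniform_dirac:
  assumes "finite A" "A \<noteq> {}" "S \<in> sets borel" "A \<subseteq> S"
  shows "AE x in uniform_dirac A. x \<in> S"
proof -
  interpret real_distribution "uniform_dirac A"
    using assms by (intro real_distribution_uniform_dirac)
  have "emeasure (uniform_dirac A) S = ennreal (1 / real (card A)) * (\<Sum>a\<in>A. 1)"
    using assms by (subst emeasure_uniform_dirac) (auto simp: subset_iff indicator_def Int_absorb2)
  also have "\<dots> = ennreal (1 / real (card A)) * ennreal (real (card A))"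
    by (simp add: ennreal_of_nat_eq_real_of_nat)
  also have "\<dots> = 1"
    using assms by (subst ennreal_mult[symmetric]) (auto simp: card_gt_0_iff)
  finally have "prob S = 1" by (simp add: measure_def)
  with assms show ?thesis by (intro AE_prob_1)
qed

lemma char_convolution:
  assumes "real_distribution M" "real_distribution N"
  shows "char (M \<star> N) t = char M t * char N t"
proof -
  interpret M: real_distribution M by fact
  interpret N: real_distribution N by fact
  interpret pair_prob_space M N ..
  have "char (M \<star> N) t = (\<integral>z. iexp (t * (fst z + snd z)) \<partial>(M \<Otimes>\<^sub>M N))"
    unfolding char_def convolution_def by (subst integral_distr) (auto simp: case_prod_beta)
  also have "\<dots> = (\<integral>x. \<integral>y. iexp (t * (x + y)) \<partial>N \<partial>M)"
  proof -
    have "integrable (M \<Otimes>\<^sub>M N) (\<lambda>z. iexp (t * (fst z + snd z)))"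
      by (intro integrable_iexp) auto
    from integral_fst'[OF this] show ?thesis by simp
  qed
  also have "\<dots> = (\<integral>x. iexp (t * x) * (\<integral>y. iexp (t * y) \<partial>N) \<partial>M)"
    by (simp add: ring_distribs exp_add)
  also have "\<dots> = char M t * char N t"
    by (simp add: char_def)
  finally show ?thesis .
qed

lemma AE_convolution:
  assumes "real_distribution M" "real_distribution N"
    and M: "AE x in M. x \<in> {a..b}" and N: "AE x in N. x \<in> {c..d}"
  shows "AE x in (M \<star> N). x \<in> {a+c..b+(d::real)}"
proof -
  interpret M: real_distribution M by fact
  interpret N: real_distribution N by fact
  interpret pair_prob_space M N ..
  have "AE z in M \<Otimes>\<^sub>M N. (case z of (x, y) \<Rightarrow> x + y) \<in> {a+c..b+d}"
  proof (rule AE_pair_measure)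
    show "{z \<in> space (M \<Otimes>\<^sub>M N). (case z of (x, y) \<Rightarrow> x + y) \<in> {a+c..b+d}} \<in> sets (M \<Otimes>\<^sub>M N)"
      by measurable
    show "AE x in M. AE y in N. (case (x, y) of (x, y) \<Rightarrow> x + y) \<in> {a+c..b+d}"
      using M
    proof eventually_elim
      case (elim x)
      show ?case using N by eventually_elim (use elim in auto)
    qed
  qed
  then show ?thesis
    unfolding convolution_def by (subst AE_distr_iff) auto
qed

text \<open>The truncated distance to the interval is bounded and continuous and vanishes exactly on
  the interval. Its integrals against \<open>\<mu> n\<close> are 0, so the integral against the weak
  limit is 0 as well.\<close>

lemma weak_conv_AE_Icc:
  assumes "\<And>n. real_distribution (\<mu> n)" "real_distribution M" "weak_conv_m \<mu> M"
    and supp: "\<And>n. AE x in \<mu> n. x \<in> {a..b}" and "a \<le> b"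
  shows "AE x in M. x \<in> {a..b}"
proof -
  interpret M: real_distribution M by fact
  interpret \<mu>: real_distribution "\<mu> n" for n by fact
  define f where "f x = min 1 (infdist x {a..b})" for x :: real
  have cont: "continuous_on UNIV f"
    unfolding f_def by (intro continuous_intros)
  then have [measurable]: "f \<in> borel_measurable borel"
    by (rule borel_measurable_continuous_onI)
  have f01: "0 \<le> f x" "f x \<le> 1" for x
    by (auto simp: f_def infdist_nonneg)
  have "(\<lambda>n. integral\<^sup>L (\<mu> n) f) \<longlonglongrightarrow> integral\<^sup>L M f"
    using assms(1-3)
    by (rule weak_conv_imp_integral_bdd_continuous_conv[where B=1])
       (use cont f01 in \<open>auto simp: continuous_on_eq_continuous_within\<close>)
  moreover have "integral\<^sup>L (\<mu> n) f = 0" for n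
  proof -
    have "integral\<^sup>L (\<mu> n) f = (\<integral>x. 0 \<partial>\<mu> n)"
    proof (rule integral_cong_AE)
      show "AE x in \<mu> n. f x = 0"
        using supp[of n] by (rule eventually_mono) (auto simp: f_def)
    qed simp_all
    then show ?thesis by simp
  qed
  ultimately have "integral\<^sup>L M f = 0"
    by (simp add: LIMSEQ_const_iff)
  moreover have "integrable M f"
    by (rule M.integrable_const_bound[where B=1]) (use f01 in auto)
  ultimately have "AE x in M. f x = 0"
    using f01 by (subst (asm) integral_nonneg_eq_0_iff_AE) auto
  then show ?thesis
  proof eventually_elim
    case (elim x)
    then have "infdist x {a..b} = 0"
      by (auto simp: f_def min_def split: if_splits)
    then show ?case
      using \<open>a \<le> b\<close> in_closed_iff_infdist_zero[of "{a..b}" x] by auto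
  qed
qed

section \<open>Finite convolutions of the digit measures and their weak limit\<close>

locale digit_sequence =
  fixes N :: "nat \<Rightarrow> nat" and B :: "nat \<Rightarrow> int set"
  assumes N_ge_2: "k \<ge> 1 \<Longrightarrow> N k \<ge> 2"
    and B_nonempty: "k \<ge> 1 \<Longrightarrow> B k \<noteq> {}"
    and B_digits: "k \<ge> 1 \<Longrightarrow> B k \<subseteq> {0..int (N k) - 1}"
begin

lemma B_finite: "k \<ge> 1 \<Longrightarrow> finite (B k)"
  using B_digits finite_subset by blast

lemma base_prod_ge: "2 ^ n \<le> base_prod N n"
proof (induction n)
  case (Suc n)
  have "2 ^ n * 2 \<le> base_prod N n * N (Suc n)"
    using Suc N_ge_2[of "Suc n"] by (intro mult_mono) auto
  then show ?case by simp
qed simp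

lemma base_prod_pos: "base_prod N n > 0"
  using base_prod_ge[of n] by (metis gr0I not_less zero_less_numeral zero_less_power le_zero_eq)

lemma filterlim_base_prod: "filterlim (\<lambda>n. real (base_prod N n)) at_top sequentially"
proof (rule filterlim_at_top_mono)
  show "filterlim (\<lambda>n. 2 ^ n :: real) at_top sequentially"
    using LIMSEQ_inverse_realpow_zero[of 2]
    by (intro filterlim_inverse_at_top[of "\<lambda>n. inverse (2 ^ n)", simplified]) auto
  show "\<forall>\<^sub>F n in sequentially. 2 ^ n \<le> real (base_prod N n)"
    using base_prod_ge by (intro always_eventually allI) (metis of_nat_le_iff of_nat_numeral of_nat_power)
qed

definition level :: "nat \<Rightarrow> real measure" where
  "level n = uniform_dirac ((\<lambda>b. real_of_int b / real (\<Prod>k=1..n. N k)) ` B n)"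

lemma level_eq: "level n = uniform_dirac ((\<lambda>b. real_of_int b / base_prod N n) ` B n)"
  by (simp add: level_def base_prod_def)

lemma real_distribution_level: "k \<ge> 1 \<Longrightarrow> real_distribution (level k)"
  unfolding level_eq using B_finite B_nonempty by (intro real_distribution_uniform_dirac) auto

lemma char_level:
  assumes "k \<ge> 1"
  shows "char (level k) (2 * pi * \<xi>) = mask_poly (B k) (\<xi> / base_prod N k)"
proof -
  have inj: "inj_on (\<lambda>b. real_of_int b / base_prod N k) (B k)"
    using base_prod_pos[of k] by (auto simp: inj_on_def)
  show ?thesis
    unfolding level_eq using assms B_finite
    by (subst char_uniform_dirac) (auto simp: mask_poly_def sum.reindex[OF inj] card_image[OF inj] mult.assoc)
qed

abbreviation "fconv \<equiv> finite_convolution level"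

lemma real_distribution_fconv: "real_distribution (fconv n)"
  by (rule real_distribution_finite_convolution) (rule real_distribution_level)

lemma char_fconv: "char (fconv n) (2 * pi * \<xi>) = mask_poly_prod N B n \<xi>"
proof (induction n)
  case 0
  show ?case by (simp add: char_def integral_return)
next
  case (Suc n)
  then show ?case
    by (simp add: char_convolution real_distribution_fconv real_distribution_level char_level
        del: base_prod_Suc)
qed

text \<open>The largest digit contributes at most
  \<open>(N (Suc n) - 1) / base_prod N (Suc n)\<close>, which equals
  \<open>1 / base_prod N n - 1 / base_prod N (Suc n)\<close>, so the right endpoints
  telescope.\<close>

lemma AE_fconv: "AE x in fconv n. x \<in> {0..1 - 1 / base_prod N n}"
proof (induction n)
  case 0
  show ?case unfolding finite_convolution.simps by (subst AE_return) auto
next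
  case (Suc n)
  have pos: "real (base_prod N n) > 0" "real (N (Suc n)) > 0"
    using base_prod_pos[of n] N_ge_2[of "Suc n"] by auto
  have "AE x in level (Suc n). x \<in> {0..1 / base_prod N n - 1 / base_prod N (Suc n)}"
    unfolding level_eq
  proof (rule AE_uniform_dirac)
    show "(\<lambda>b. real_of_int b / real (base_prod N (Suc n))) ` B (Suc n)
          \<subseteq> {0..1 / base_prod N n - 1 / base_prod N (Suc n)}"
    proof safe
      fix b assume "b \<in> B (Suc n)"
      with B_digits[of "Suc n"] have b: "0 \<le> b" "b \<le> int (N (Suc n)) - 1" by auto
      then have b': "real_of_int b \<le> real (N (Suc n)) - 1" by linarith
      have "real_of_int b / base_prod N (Suc n) \<le> (real (N (Suc n)) - 1) / base_prod N (Suc n)"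
        using b' by (intro divide_right_mono) auto
      also have "\<dots> = 1 / base_prod N n - 1 / base_prod N (Suc n)"
        using pos by (simp add: field_simps)
      finally show "real_of_int b / real (base_prod N (Suc n)) \<in> {0..1 / base_prod N n - 1 / base_prod N (Suc n)}"
        using b by simp
    qed
  qed (use B_finite B_nonempty in auto)
  from AE_convolution[OF real_distribution_fconv real_distribution_level Suc this]
  show ?case unfolding finite_convolution.simps by (simp only: diff_add_eq_diff_diff_swap add_0 add.right_neutral diff_add_cancel add_diff_eq)
qed

lemma AE_fconv_01: "AE x in fconv n. x \<in> {0..1}"
  using AE_fconv[of n]
proof eventually_elim
  case (elim x)
  then show ?case using base_prod_pos[of n] by (auto intro: order_trans)
qed

text \<open>Partial products have norm at most 1, so a successive difference is bounded by the
  distance of the new factor from 1. These distances are dominated by a geometric series, and the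
  differences telescope.\<close>

lemma convergent_mask_poly_prod: "convergent (\<lambda>n. mask_poly_prod N B n \<xi>)"
proof -
  have "summable (\<lambda>n. mask_poly_prod N B (Suc n) \<xi> - mask_poly_prod N B n \<xi>)"
  proof (rule summable_comparison_test')
    show "summable (\<lambda>n. 2 * pi * \<bar>\<xi>\<bar> * (1 / 2) ^ n)"
      by (intro summable_mult summable_geometric) simp
    fix n :: nat assume "n \<ge> 0"
    have le1: "cmod (mask_poly_prod N B n \<xi>) \<le> 1"
      unfolding mask_poly_prod_def prod_norm[symmetric] by (intro prod_le_1) (auto simp: norm_mask_poly_le_1)
    have "cmod (mask_poly_prod N B (Suc n) \<xi> - mask_poly_prod N B n \<xi>)
        = cmod (mask_poly_prod N B n \<xi>) * cmod (mask_poly (B (Suc n)) (\<xi> / base_prod N (Suc n)) - 1)"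
      by (simp add: norm_mult[symmetric] algebra_simps)
    also have "\<dots> \<le> 1 * (2 * pi * \<bar>\<xi> / base_prod N (Suc n)\<bar> * real (N (Suc n)))"
      using B_finite[of "Suc n"] B_nonempty[of "Suc n"] B_digits[of "Suc n"]
      by (intro mult_mono le1 norm_mask_poly_minus_1_le) auto
    also have "\<dots> = 2 * pi * \<bar>\<xi>\<bar> * (1 / base_prod N n)"
      using base_prod_pos[of n] N_ge_2[of "Suc n"] by (simp add: abs_mult field_simps)
    also have "\<dots> \<le> 2 * pi * \<bar>\<xi>\<bar> * (1 / 2 ^ n)"
    proof (intro mult_left_mono divide_left_mono)
      show "2 ^ n \<le> real (base_prod N n)"
        using base_prod_ge[of n] by (metis of_nat_le_iff of_nat_numeral of_nat_power)
    qed (use base_prod_pos[of n] in auto)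
    finally show "cmod (mask_poly_prod N B (Suc n) \<xi> - mask_poly_prod N B n \<xi>) \<le> 2 * pi * \<bar>\<xi>\<bar> * (1 / 2) ^ n"
      by (simp add: power_one_over)
  qed
  then have "convergent (\<lambda>n. \<Sum>i<n. mask_poly_prod N B (Suc i) \<xi> - mask_poly_prod N B i \<xi>)"
    by (simp add: summable_iff_convergent)
  then have "convergent (\<lambda>n. mask_poly_prod N B n \<xi> - mask_poly_prod N B 0 \<xi>)"
    using sum_lessThan_telescope[of "\<lambda>n. mask_poly_prod N B n \<xi>"] by simp
  then have "convergent (\<lambda>n. (mask_poly_prod N B n \<xi> - 1) + 1)"
    by (intro convergent_add convergent_const) simp
  then show ?thesis by simp
qed

text \<open>Tightness yields a weak limit along a subsequence. The characteristic functions converge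
  along the whole sequence, necessarily to that of this limit, and Levy's continuity theorem
  upgrades the convergence.\<close>

lemma weak_limit_exists: "\<exists>M. real_distribution M \<and> weak_conv_m fconv M"
proof -
  have "tight fconv"
    unfolding tight_def
  proof (intro conjI allI impI)
    show "real_distribution (fconv n)" for n by (rule real_distribution_fconv)
    fix \<epsilon> :: real assume "0 < \<epsilon>"
    \<comment> \<open>Tightness uses intervals open on the left, so the left endpoint has to lie
      below 0.\<close>
    have "1 - \<epsilon> < measure (fconv n) {-1<..2}" for n
    proof -
      interpret real_distribution "fconv n" by (rule real_distribution_fconv)
      have "prob {-1<..2} = 1"
        using AE_fconv_01[of n] by (subst prob_eq_1) (auto elim: eventually_mono)
      with \<open>0 < \<epsilon>\<close> show ?thesis by simp
    qed
    then show "\<exists>a b. a < b \<and> (\<forall>n. 1 - \<epsilon> < measure (fconv n) {a<..b})"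
      by (intro exI[of _ "-1"] exI[of _ 2]) auto
  qed
  from tight_imp_convergent_subsubsequence[OF this strict_mono_id]
  obtain r M where r: "strict_mono r" and M: "real_distribution M" "weak_conv_m (fconv \<circ> r) M"
    by (auto simp: comp_def)
  have "weak_conv_m fconv M"
  proof (rule levy_continuity[OF real_distribution_fconv M(1)])
    fix t
    obtain l where l: "(\<lambda>n. char (fconv n) t) \<longlonglongrightarrow> l"
      using convergent_mask_poly_prod[of "t / (2 * pi)"] char_fconv[of _ "t / (2 * pi)"]
      by (auto simp: convergent_def)
    have "(\<lambda>n. char ((fconv \<circ> r) n) t) \<longlonglongrightarrow> char M t"
      using M by (intro levy_continuity1) (simp_all add: real_distribution_fconv comp_def)
    moreover have "(\<lambda>n. char ((fconv \<circ> r) n) t) \<longlonglongrightarrow> l"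
      using LIMSEQ_subseq_LIMSEQ[OF l r] by (simp add: comp_def)
    ultimately show "(\<lambda>n. char (fconv n) t) \<longlonglongrightarrow> char M t"
      using l LIMSEQ_unique by blast
  qed
  with M show ?thesis by blast
qed

lemma cantor_moran:
  shows real_distribution_cantor_moran: "real_distribution (cantor_moran_measure N B)"
    and AE_cantor_moran: "AE x in cantor_moran_measure N B. x \<in> {0..1}"
    and char_cantor_moran:
      "(\<lambda>n. mask_poly_prod N B n \<xi>) \<longlonglongrightarrow> char (cantor_moran_measure N B) (2 * pi * \<xi>)"
proof -
  obtain M where M: "real_distribution M" "weak_conv_m fconv M"
    using weak_limit_exists by blast
  have eq: "cantor_moran_measure N B = M"
    unfolding cantor_moran_measure_def level_def[symmetric]
    using real_distribution_level M by (rule infinite_convolution_eqI)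
  show "real_distribution (cantor_moran_measure N B)"
    using M eq by simp
  show "AE x in cantor_moran_measure N B. x \<in> {0..1}"
    unfolding eq using real_distribution_fconv M AE_fconv_01 by (rule weak_conv_AE_Icc) simp
  show "(\<lambda>n. mask_poly_prod N B n \<xi>) \<longlonglongrightarrow> char (cantor_moran_measure N B) (2 * pi * \<xi>)"
    unfolding eq char_fconv[symmetric] using real_distribution_fconv M by (rule levy_continuity1)
qed

end


section \<open>Bounds for Fourier transforms of measures on the unit interval\<close>

lemma char_diff_le:
  assumes "real_distribution M" and supp: "AE x in M. x \<in> {0..1}"
  shows "cmod (char M (2 * pi * \<xi>) - char M (2 * pi * \<eta>)) \<le> 2 * pi * \<bar>\<xi> - \<eta>\<bar>"
proof -
  interpret real_distribution M by fact
  have int: "integrable M (\<lambda>x. iexp (t * x))" for t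
    by (intro integrable_iexp) auto
  have "cmod (char M (2 * pi * \<xi>) - char M (2 * pi * \<eta>))
      = cmod (\<integral>x. iexp (2 * pi * \<xi> * x) - iexp (2 * pi * \<eta> * x) \<partial>M)"
    unfolding char_def by (subst Bochner_Integration.integral_diff[OF int int]) (rule refl)
  also have "\<dots> \<le> (\<integral>x. cmod (iexp (2 * pi * \<xi> * x) - iexp (2 * pi * \<eta> * x)) \<partial>M)"
    by (rule integral_norm_bound)
  also have "\<dots> \<le> (\<integral>x. 2 * pi * \<bar>\<xi> - \<eta>\<bar> \<partial>M)"
  proof (rule integral_mono_AE)
    show "integrable M (\<lambda>x. cmod (iexp (2 * pi * \<xi> * x) - iexp (2 * pi * \<eta> * x)))"
      by (intro integrable_norm Bochner_Integration.integrable_diff int)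
    show "AE x in M. cmod (iexp (2 * pi * \<xi> * x) - iexp (2 * pi * \<eta> * x)) \<le> 2 * pi * \<bar>\<xi> - \<eta>\<bar>"
      using supp
    proof eventually_elim
      case (elim x)
      have "cmod (cis (2 * pi * \<xi> * x) - cis (2 * pi * \<eta> * x)) \<le> \<bar>2 * pi * \<xi> * x - 2 * pi * \<eta> * x\<bar>"
        by (rule norm_cis_diff_le)
      also have "\<dots> = 2 * pi * \<bar>\<xi> - \<eta>\<bar> * x"
        using elim by (simp add: abs_mult left_diff_distrib[symmetric] right_diff_distrib[symmetric])
      also have "\<dots> \<le> 2 * pi * \<bar>\<xi> - \<eta>\<bar> * 1"
        using elim by (intro mult_left_mono) auto
      finally show ?case by (simp add: cis_conv_exp)
    qed
  qed simp
  finally show ?thesis by (simp add: prob_space del: space_eq_univ)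
qed

text \<open>Multiplication by \<open>cis (- pi * \<xi>)\<close> centres the support at 0 without
  changing the modulus. The phases become \<open>pi * \<xi> * (2 * x - 1)\<close>, which lie between
  \<open>- pi * a\<close> and \<open>pi * a\<close>, so the real part of the integrand is at least
  \<open>cos (pi * a)\<close>.\<close>

lemma char_lower_bound:
  assumes "real_distribution M" and supp: "AE x in M. x \<in> {0..1}"
    and "\<bar>\<xi>\<bar> \<le> a" "a \<le> 1 / 2"
  shows "cos (pi * a) \<le> cmod (char M (2 * pi * \<xi>))"
proof -
  interpret real_distribution M by fact
  have int: "integrable M (\<lambda>x. iexp (t * x))" for t
    by (intro integrable_iexp) auto
  have "cos (pi * a) = (\<integral>x. cos (pi * a) \<partial>M)"
    by (simp add: prob_space del: space_eq_univ)
  also have "\<dots> \<le> (\<integral>x. Re (cis (- pi * \<xi>) * iexp (2 * pi * \<xi> * x)) \<partial>M)"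
  proof (rule integral_mono_AE)
    show "integrable M (\<lambda>x. Re (cis (- pi * \<xi>) * iexp (2 * pi * \<xi> * x)))"
      by (intro integrable_Re integrable_mult_right int)
    show "AE x in M. cos (pi * a) \<le> Re (cis (- pi * \<xi>) * iexp (2 * pi * \<xi> * x))"
      using supp
    proof eventually_elim
      case (elim x)
      have "Re (cis (- pi * \<xi>) * iexp (2 * pi * \<xi> * x)) = cos (pi * (\<xi> * (2 * x - 1)))"
        unfolding cis_conv_exp[symmetric] cis_mult by (simp add: algebra_simps)
      also have "\<dots> = cos (pi * \<bar>\<xi> * (2 * x - 1)\<bar>)"
        using cos_abs_real[of "pi * (\<xi> * (2 * x - 1))"] by (simp add: abs_mult)
      also have "cos (pi * a) \<le> \<dots>"
      proof (rule cos_monotone_0_pi_le)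
        have "\<bar>\<xi> * (2 * x - 1)\<bar> \<le> a * 1"
          unfolding abs_mult using elim assms by (intro mult_mono) (auto simp: abs_le_iff)
        then show "pi * \<bar>\<xi> * (2 * x - 1)\<bar> \<le> pi * a" by simp
        show "pi * a \<le> pi" using assms by simp
      qed simp
      finally show ?case .
    qed
  qed simp
  also have "\<dots> = Re (cis (- pi * \<xi>) * char M (2 * pi * \<xi>))"
    unfolding char_def
    by (subst integral_Re[OF integrable_mult_right[OF int]], subst integral_mult_right_zero) (rule refl)
  also have "\<dots> \<le> cmod (cis (- pi * \<xi>) * char M (2 * pi * \<xi>))"
    by (rule complex_Re_le_cmod)
  finally show ?thesis by (simp add: norm_mult)
qed

text \<open>The digits divided by \<open>N - 1\<close> lie in the unit interval, so
  \<open>char_lower_bound\<close> applies. Dividing by \<open>N - 1\<close> rather than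
  \<open>N\<close> is what later leaves a margin below \<open>1 / 2\<close>.\<close>

lemma mask_poly_lower_bound:
  assumes B: "B \<noteq> {}" "B \<subseteq> {0..int N - 1}" and "N \<ge> 2"
    and "\<bar>\<eta>\<bar> * (real N - 1) \<le> a" "a \<le> 1 / 2"
  shows "cos (pi * a) \<le> cmod (mask_poly B \<eta>)"
proof -
  have fin: "finite B" using B finite_subset by blast
  let ?f = "\<lambda>b. real_of_int b / (real N - 1)"
  have inj: "inj_on ?f B" using \<open>N \<ge> 2\<close> by (auto simp: inj_on_def)
  have img: "?f ` B \<subseteq> {0..1}"
  proof safe
    fix b assume "b \<in> B"
    with B have "0 \<le> b" "b \<le> int N - 1" by auto
    then have "0 \<le> real_of_int b" "real_of_int b \<le> real N - 1" by linarith+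
    then show "?f b \<in> {0..1}" using \<open>N \<ge> 2\<close> by simp
  qed
  have "cos (pi * a) \<le> cmod (char (uniform_dirac (?f ` B)) (2 * pi * (\<eta> * (real N - 1))))"
  proof (rule char_lower_bound)
    show "real_distribution (uniform_dirac (?f ` B))"
      using fin B by (intro real_distribution_uniform_dirac) auto
    show "AE x in uniform_dirac (?f ` B). x \<in> {0..1}"
      using fin B img by (intro AE_uniform_dirac) auto
  qed (use assms in \<open>auto simp: abs_mult\<close>)
  also have "char (uniform_dirac (?f ` B)) (2 * pi * (\<eta> * (real N - 1))) = mask_poly B \<eta>"
    using fin \<open>N \<ge> 2\<close>
    by (subst char_uniform_dirac) (auto simp: mask_poly_def sum.reindex[OF inj] card_image[OF inj] mult.assoc)
  finally show ?thesis .
qed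

section \<open>Exponential sums with digits from a Hadamard triple\<close>

lemma hadamard_matrix_eq_cis:
  "hadamard_matrix N B b l = cis (- 2 * pi * (of_int b * of_int l / N)) / of_real (sqrt (card B))"
  by (simp add: hadamard_matrix_def cis_conv_exp field_simps)

text \<open>Up to the factor \<open>1 / sqrt (card B)\<close>, the values of
  \<open>mask_poly\<close> at the shifts by \<open>l / N\<close> are the coordinates of the
  unimodular vector \<open>u\<close> under the conjugate Hadamard matrix. Unitarity preserves the
  squared norm \<open>card B\<close> of \<open>u\<close>.\<close>

lemma hadamard_triple_sum:
  assumes "hadamard_triple N B L"
  shows "(\<Sum>l\<in>L. (cmod (mask_poly B (\<xi> + of_int l / N)))\<^sup>2) = 1"
proof -
  let ?H = "hadamard_matrix N B"
  define u where "u b = cis (2 * pi * (\<xi> * of_int b))" for b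
  have fin: "finite B" "finite L" and ne: "B \<noteq> {}"
    and rows: "\<And>b b'. b \<in> B \<Longrightarrow> b' \<in> B \<Longrightarrow> (\<Sum>l\<in>L. ?H b l * cnj (?H b' l)) = (if b = b' then 1 else 0)"
    using assms by (auto simp: hadamard_triple_def unitary_on_def)
  have card: "card B > 0" using fin ne by (simp add: card_gt_0_iff)
  define s where "s = complex_of_real (sqrt (card B))"
  have s: "s * s = of_nat (card B)" "s \<noteq> 0" "cnj s = s"
    using card unfolding s_def by (simp_all add: of_real_mult[symmetric] del: of_real_mult)
  have mask: "mask_poly B (\<xi> + of_int l / N) = (\<Sum>b\<in>B. u b * cnj (?H b l)) / s" for l
  proof -
    have "u b * cnj (?H b l) = cis (2 * pi * ((\<xi> + of_int l / N) * of_int b)) / s" for b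
      by (simp add: u_def hadamard_matrix_eq_cis cis_cnj cis_mult algebra_simps s_def)
    then show ?thesis
      by (simp add: mask_poly_def s(1)[symmetric] sum_divide_distrib)
  qed
  have "complex_of_real (\<Sum>l\<in>L. (cmod (mask_poly B (\<xi> + of_int l / N)))\<^sup>2)
      = (\<Sum>l\<in>L. mask_poly B (\<xi> + of_int l / N) * cnj (mask_poly B (\<xi> + of_int l / N)))"
    by (simp add: complex_norm_square del: of_real_power)
  also have "\<dots> = (\<Sum>l\<in>L. \<Sum>b\<in>B. \<Sum>b'\<in>B. u b * cnj (u b') * (?H b' l * cnj (?H b l))) / (s * s)"
    by (simp add: mask s sum_product sum_divide_distrib mult_ac)
  also have "(\<Sum>l\<in>L. \<Sum>b\<in>B. \<Sum>b'\<in>B. u b * cnj (u b') * (?H b' l * cnj (?H b l)))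
      = (\<Sum>b\<in>B. \<Sum>l\<in>L. \<Sum>b'\<in>B. u b * cnj (u b') * (?H b' l * cnj (?H b l)))"
    by (rule sum.swap)
  also have "\<dots> = (\<Sum>b\<in>B. \<Sum>b'\<in>B. \<Sum>l\<in>L. u b * cnj (u b') * (?H b' l * cnj (?H b l)))"
    by (intro sum.cong refl sum.swap)
  also have "\<dots> = (\<Sum>b\<in>B. \<Sum>b'\<in>B. u b * cnj (u b') * (if b' = b then 1 else 0))"
    by (intro sum.cong refl) (simp add: sum_distrib_left[symmetric] rows)
  also have "\<dots> = (\<Sum>b\<in>B. 1)"
    using fin by (intro sum.cong refl) (simp add: u_def cis_cnj cis_mult if_distrib cong: if_cong)
  also have "(\<Sum>b\<in>B. 1) / (s * s) = 1"
    using card by (simp add: s)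
  finally show ?thesis
    by (metis of_real_eq_1_iff)
qed

text \<open>Turan's inequality for exponential sums. Eliminating the node \<open>w b\<close> replaces the power
  sums \<open>s i\<close> by \<open>s i - s (i + 1) / w b\<close>.\<close>

lemma power_sums_small_imp_sum_small:
  fixes w c :: "'a \<Rightarrow> complex"
  assumes "finite A" "\<And>b. b \<in> A \<Longrightarrow> cmod (w b) = 1"
    and "\<And>i. i \<in> {1..card A} \<Longrightarrow> cmod (\<Sum>b\<in>A. c b * w b ^ i) \<le> \<delta>"
  shows "cmod (\<Sum>b\<in>A. c b) \<le> (2 ^ card A - 1) * \<delta>"
  using assms
proof (induction A arbitrary: c \<delta> rule: finite_induct)
  case (insert a A)
  define S where "S i = (\<Sum>b\<in>insert a A. c b * w b ^ i)" for i
  define c' where "c' b = c b * (1 - w b / w a)" for b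
  have wa: "w a \<noteq> 0" "cmod (w a) = 1" using insert.prems(1)[of a] by auto
  have S': "(\<Sum>b\<in>A. c' b * w b ^ i) = S i - S (Suc i) / w a" for i
  proof -
    have "S i - S (Suc i) / w a = (\<Sum>b\<in>insert a A. c' b * w b ^ i)"
      unfolding S_def c'_def sum_divide_distrib sum_subtractf[symmetric]
      by (intro sum.cong refl) (simp add: algebra_simps)
    also have "\<dots> = (\<Sum>b\<in>A. c' b * w b ^ i)"
      using insert.hyps wa by (simp add: c'_def)
    finally show ?thesis by simp
  qed
  have S: "cmod (S i) \<le> \<delta>" if "i \<in> {1..Suc (card A)}" for i
    unfolding S_def using insert.prems(2)[of i] insert.hyps that by simp
  have "cmod (\<Sum>b\<in>A. c' b * w b ^ i) \<le> 2 * \<delta>" if "i \<in> {1..card A}" for i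
  proof -
    have "cmod (S i - S (Suc i) / w a) \<le> cmod (S i) + cmod (S (Suc i) / w a)"
      by (rule norm_triangle_ineq4)
    also have "\<dots> \<le> \<delta> + \<delta>"
      using that by (intro add_mono) (auto simp: norm_divide wa S)
    finally show ?thesis by (simp add: S')
  qed
  \<comment> \<open>The coefficient \<open>c' a\<close> is 0, so one node is gone at the cost of
    doubling \<open>\<delta>\<close>. Restoring \<open>S 0\<close> adds one more
    \<open>\<delta>\<close>, and \<open>2 * (2 ^ k - 1) + 1 = 2 ^ (k + 1) - 1\<close>.\<close>
  then have "cmod (\<Sum>b\<in>A. c' b) \<le> (2 ^ card A - 1) * (2 * \<delta>)"
    using insert.prems(1) by (intro insert.IH) auto
  then have IH: "cmod (S 0 - S (Suc 0) / w a) \<le> (2 ^ card A - 1) * (2 * \<delta>)"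
    using S'[of 0] by simp
  have "cmod (S 0) \<le> cmod (S 0 - S (Suc 0) / w a) + cmod (S (Suc 0) / w a)"
    using norm_triangle_ineq[of "S 0 - S (Suc 0) / w a" "S (Suc 0) / w a"] by simp
  also have "\<dots> \<le> (2 ^ card A - 1) * (2 * \<delta>) + \<delta>"
    by (intro add_mono IH) (simp add: norm_divide wa S)
  also have "\<dots> = (2 ^ card (insert a A) - 1) * \<delta>"
    using insert.hyps by (simp add: algebra_simps)
  finally show ?case by (simp add: S_def)
qed simp

text \<open>Along the progression the exponential sum is a power sum in the nodes
  \<open>w b\<close>, with the value at \<open>\<eta>\<close> as the sum of the coefficients. If all
  later values were small, Turan's inequality would bound this value by a proper fraction of
  itself.\<close>

lemma mask_poly_progression:
  assumes "finite B" "mask_poly B \<eta> \<noteq> 0"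
  shows "\<exists>i\<in>{1..card B}. cmod (mask_poly B \<eta>) / 2 ^ card B \<le> cmod (mask_poly B (\<eta> + real i * d))"
proof (rule ccontr)
  define \<delta> where "\<delta> = cmod (mask_poly B \<eta>) / 2 ^ card B"
  define c where "c b = cis (2 * pi * (\<eta> * of_int b)) / of_nat (card B)" for b
  define w where "w b = cis (2 * pi * (d * of_int b))" for b
  assume "\<not> ?thesis"
  then have small: "cmod (mask_poly B (\<eta> + real i * d)) \<le> \<delta>" if "i \<in> {1..card B}" for i
    using that by (force simp: \<delta>_def)
  have eq: "(\<Sum>b\<in>B. c b * w b ^ i) = mask_poly B (\<eta> + real i * d)" for i
    unfolding mask_poly_def c_def w_def sum_divide_distrib
    by (intro sum.cong refl) (simp add: Complex.DeMoivre cis_mult algebra_simps)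
  have "cmod (\<Sum>b\<in>B. c b) \<le> (2 ^ card B - 1) * \<delta>"
    using assms(1) by (rule power_sums_small_imp_sum_small[where w=w]) (use small in \<open>auto simp: eq, simp add: w_def\<close>)
  moreover have "(2 ^ card B - 1) * \<delta> = cmod (mask_poly B \<eta>) - \<delta>"
    by (simp add: \<delta>_def field_simps)
  ultimately have "cmod (mask_poly B \<eta>) \<le> cmod (mask_poly B \<eta>) - \<delta>"
    using eq[of 0] by simp
  moreover have "\<delta> > 0"
    using assms by (simp add: \<delta>_def)
  ultimately show False by simp
qed

text \<open>If the large value provided by the Hadamard property lies near the edge of the period, a
  progression of step about \<open>1 / (4 * m)\<close> carries it back into the interior.\<close>

lemma hadamard_triple_large_value:
  assumes H: "hadamard_triple N B L" and m: "card B \<le> m" "4 * m \<le> N"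
  obtains k :: int where "\<bar>(x + of_int k) / N\<bar> \<le> 1 / 2 - 1 / (4 * real m)"
    and "1 / (real m * 2 ^ m) \<le> cmod (mask_poly B ((x + of_int k) / N))"
proof -
  have fin: "finite B" "finite L" and ne: "B \<noteq> {}" and card: "card L = card B"
    using H by (auto simp: hadamard_triple_def)
  have c0: "card B > 0" using fin ne by (simp add: card_gt_0_iff)
  with m have m0: "m > 0" and N0: "N > 0" by auto
  \<comment> \<open>Pigeonhole: the squares add up to 1 over \<open>card B\<close> indices.\<close>
  have "\<exists>l\<in>L. 1 / card B \<le> (cmod (mask_poly B (x / N + of_int l / N)))\<^sup>2"
  proof (rule ccontr)
    assume "\<not> ?thesis"
    then have "(\<Sum>l\<in>L. (cmod (mask_poly B (x / N + of_int l / N)))\<^sup>2) < (\<Sum>l\<in>L. 1 / card B)"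
      using fin c0 card by (intro sum_strict_mono) auto
    with c0 card show False
      by (simp add: hadamard_triple_sum[OF H])
  qed
  then obtain l where l: "1 / card B \<le> (cmod (mask_poly B (x / N + of_int l / N)))\<^sup>2" by blast
  \<comment> \<open>By periodicity the point may be moved into the period centred at 0; on the level
    of \<open>x\<close> this is a shift by the integer \<open>j * N\<close>.\<close>
  define j where "j = round (x / N + of_int l / N)"
  define \<eta> where "\<eta> = x / N + of_int l / N - of_int j"
  have \<eta>_eq: "\<eta> = (x + of_int (l - j * int N)) / N"
    using N0 by (simp add: \<eta>_def field_simps)
  have \<eta>_half: "\<bar>\<eta>\<bar> \<le> 1 / 2"
    using of_int_round_abs_le[of "x / N + of_int l / N"] unfolding \<eta>_def j_def by linarith
  have "mask_poly B \<eta> = mask_poly B (x / N + of_int l / N)"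
    using mask_poly_add_int[of B \<eta> j] by (simp add: \<eta>_def)
  with l have "1 / card B \<le> (cmod (mask_poly B \<eta>))\<^sup>2" by simp
  then have "1 / real m \<le> (cmod (mask_poly B \<eta>))\<^sup>2"
    using m c0 by (meson frac_le le_numeral_extra(4) of_nat_0_less_iff of_nat_mono order_trans zero_le_one)
  moreover have "(cmod (mask_poly B \<eta>))\<^sup>2 \<le> cmod (mask_poly B \<eta>)"
    using norm_mask_poly_le_1[of B \<eta>] by (simp add: power2_eq_square mult_left_le)
  ultimately have large: "1 / real m \<le> cmod (mask_poly B \<eta>)" by simp
  have quarter: "1 / (4 * real m) \<le> 1 / 4" using m0 by (simp add: field_simps)
  show thesis
  proof (cases "\<bar>\<eta>\<bar> \<le> 1 / 4")
    case True
    show thesis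
    proof (rule that[of "l - j * int N"])
      show "\<bar>(x + of_int (l - j * int N)) / N\<bar> \<le> 1 / 2 - 1 / (4 * real m)"
        unfolding \<eta>_eq[symmetric] using True quarter by linarith
      have "1 / (real m * 2 ^ m) \<le> 1 / (real m * 1)"
        using m0 by (intro divide_left_mono mult_left_mono) auto
      then show "1 / (real m * 2 ^ m) \<le> cmod (mask_poly B ((x + of_int (l - j * int N)) / N))"
        unfolding \<eta>_eq[symmetric] using large by simp
    qed
  next
    case False
    \<comment> \<open>Integrality of \<open>d\<close> keeps the progression in the coset of
      \<open>x\<close>. Because \<open>4 * m \<le> N\<close>, rounding up at most doubles the step,
      so \<open>d / N\<close> lies between \<open>1 / (4 * m)\<close> and
      \<open>1 / (2 * m)\<close>, and at most \<open>m\<close> steps move by at least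
      \<open>1 / (4 * m)\<close> and at most \<open>1 / 2\<close>. The sign \<open>\<sigma>\<close>
      directs the motion towards 0; starting beyond \<open>1 / 4\<close>, it cannot overshoot past
      \<open>1 / 4\<close> on the other side.\<close>
    define d where "d = \<lceil>N / (4 * real m)\<rceil>"
    define \<sigma> :: int where "\<sigma> = (if \<eta> > 0 then - 1 else 1)"
    have N4: "1 \<le> N / (4 * real m)" using m m0 by (simp add: field_simps)
    have d_ge: "1 / (4 * real m) \<le> of_int d / N"
    proof -
      have "N / (4 * real m) \<le> of_int d" unfolding d_def by (rule le_of_int_ceiling)
      then show ?thesis using N0 m0 by (simp add: field_simps)
    qed
    have d_le: "of_int d / N \<le> 1 / (2 * real m)"
    proof -
      have "of_int d \<le> N / (4 * real m) + 1" unfolding d_def by linarith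
      with N4 have "of_int d \<le> 2 * (N / (4 * real m))" by linarith
      then show ?thesis using N0 m0 by (simp add: field_simps)
    qed
    have "0 < 1 / real m" using m0 by simp
    with large have nz: "mask_poly B \<eta> \<noteq> 0"
      by (metis norm_zero not_le)
    obtain i where i: "i \<in> {1..card B}"
      and big: "cmod (mask_poly B \<eta>) / 2 ^ card B \<le> cmod (mask_poly B (\<eta> + real i * (of_int (\<sigma> * d) / N)))"
      using mask_poly_progression[OF fin(1) nz] by blast
    define k where "k = l - j * int N + int i * \<sigma> * d"
    have k: "(x + of_int k) / N = \<eta> + of_int \<sigma> * (real i * (of_int d / N))"
      unfolding \<eta>_eq k_def using N0 by (simp add: field_simps)
    have lo: "1 / (4 * real m) \<le> real i * (of_int d / N)"
    proof -
      have "1 * (1 / (4 * real m)) \<le> real i * (of_int d / N)"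
        using i d_ge by (intro mult_mono) auto
      then show ?thesis by simp
    qed
    have hi: "real i * (of_int d / N) \<le> 1 / 2"
    proof -
      have "0 \<le> of_int d / real N" using d_ge by (rule order_trans[rotated]) simp
      then have "real i * (of_int d / N) \<le> real m * (1 / (2 * real m))"
        using i m d_le by (intro mult_mono) auto
      then show ?thesis using m0 by simp
    qed
    show thesis
    proof (rule that[of k])
      show "\<bar>(x + of_int k) / N\<bar> \<le> 1 / 2 - 1 / (4 * real m)"
        unfolding k \<sigma>_def using False \<eta>_half lo hi quarter by (auto simp: abs_le_iff abs_if split: if_splits)
      have "1 / (real m * 2 ^ m) = (1 / real m) / 2 ^ m" by simp
      also have "\<dots> \<le> cmod (mask_poly B \<eta>) / 2 ^ card B"
        using large m by (intro frac_le) auto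
      also note big
      also have "\<eta> + real i * (of_int (\<sigma> * d) / N) = (x + of_int k) / N"
        unfolding k by simp
      finally show "1 / (real m * 2 ^ m) \<le> cmod (mask_poly B ((x + of_int k) / N))" .
    qed
  qed
qed

section \<open>Equipositivity of the tails\<close>

context digit_sequence
begin

text \<open>The Fourier transform, with the sign convention of \<open>char\<close>, of the tail of the convolution
  after \<open>n\<close> factors, rescaled to \<open>[0, 1]\<close>.\<close>

definition tail_char :: "nat \<Rightarrow> real \<Rightarrow> complex" where
  "tail_char n \<xi> = char (cantor_moran_measure (\<lambda>k. N (n + k)) (\<lambda>k. B (n + k))) (2 * pi * \<xi>)"

lemma digit_sequence_shift: "digit_sequence (\<lambda>k. N (n + k)) (\<lambda>k. B (n + k))"
  by standard (use N_ge_2 B_nonempty B_digits in auto)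

lemma tail_char_diff_le: "cmod (tail_char n \<xi> - tail_char n \<eta>) \<le> 2 * pi * \<bar>\<xi> - \<eta>\<bar>"
proof -
  interpret T: digit_sequence "\<lambda>k. N (n + k)" "\<lambda>k. B (n + k)"
    by (rule digit_sequence_shift)
  show ?thesis
    unfolding tail_char_def by (rule char_diff_le[OF T.real_distribution_cantor_moran T.AE_cantor_moran])
qed

lemma tail_char_lower_bound:
  "\<bar>\<xi>\<bar> \<le> a \<Longrightarrow> a \<le> 1 / 2 \<Longrightarrow> cos (pi * a) \<le> cmod (tail_char n \<xi>)"
proof -
  interpret T: digit_sequence "\<lambda>k. N (n + k)" "\<lambda>k. B (n + k)"
    by (rule digit_sequence_shift)
  show "\<bar>\<xi>\<bar> \<le> a \<Longrightarrow> a \<le> 1 / 2 \<Longrightarrow> cos (pi * a) \<le> cmod (tail_char n \<xi>)"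
    unfolding tail_char_def by (rule char_lower_bound[OF T.real_distribution_cantor_moran T.AE_cantor_moran])
qed

lemma tail_char_0_at_0: "tail_char 0 0 = 1"
  using real_distribution.char_zero[OF real_distribution_cantor_moran] by (simp add: tail_char_def)

lemma norm_tail_char_le_1: "cmod (tail_char n \<xi>) \<le> 1"
proof -
  interpret T: digit_sequence "\<lambda>k. N (n + k)" "\<lambda>k. B (n + k)"
    by (rule digit_sequence_shift)
  show ?thesis
    unfolding tail_char_def by (rule real_distribution.cmod_char_le_1[OF T.real_distribution_cantor_moran])
qed

lemma base_prod_add: "base_prod N (n + k) = base_prod N n * base_prod (\<lambda>k. N (n + k)) k"
  by (induction k) auto

lemma mask_poly_prod_add:
  "mask_poly_prod N B (n + k) \<xi>
     = mask_poly_prod N B n \<xi> * mask_poly_prod (\<lambda>k. N (n + k)) (\<lambda>k. B (n + k)) k (\<xi> / base_prod N n)"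
proof (induction k)
  case (Suc k)
  have eq: "\<xi> / base_prod N (Suc (n + k)) = \<xi> / base_prod N n / base_prod (\<lambda>k. N (n + k)) (Suc k)"
    by (simp only: add_Suc_right[symmetric] base_prod_add) simp
  show ?case
    by (simp only: add_Suc_right mask_poly_prod_Suc Suc.IH eq mult.assoc)
qed simp

lemma mask_poly_prod_tendsto: "(\<lambda>n. mask_poly_prod N B n \<xi>) \<longlonglongrightarrow> tail_char 0 \<xi>"
  using char_cantor_moran[of \<xi>] by (simp add: tail_char_def)

text \<open>Both sides are limits of the same partial products, split after \<open>n\<close>
  factors.\<close>

lemma tail_char_0_eq: "tail_char 0 \<xi> = mask_poly_prod N B n \<xi> * tail_char n (\<xi> / base_prod N n)"
proof (rule LIMSEQ_unique)
  interpret T: digit_sequence "\<lambda>k. N (n + k)" "\<lambda>k. B (n + k)"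
    by (rule digit_sequence_shift)
  show "(\<lambda>k. mask_poly_prod N B (n + k) \<xi>) \<longlonglongrightarrow> tail_char 0 \<xi>"
    using LIMSEQ_ignore_initial_segment[OF mask_poly_prod_tendsto, where k=n] by (simp add: add.commute)
  show "(\<lambda>k. mask_poly_prod N B (n + k) \<xi>) \<longlonglongrightarrow> mask_poly_prod N B n \<xi> * tail_char n (\<xi> / base_prod N n)"
    unfolding mask_poly_prod_add tail_char_def by (intro tendsto_mult tendsto_const T.char_cantor_moran)
qed

text \<open>The factorization after one factor, applied to the shifted sequence.\<close>

lemma tail_char_Suc:
  "tail_char n \<xi> = mask_poly (B (Suc n)) (\<xi> / N (Suc n)) * tail_char (Suc n) (\<xi> / N (Suc n))"
proof -
  interpret T: digit_sequence "\<lambda>k. N (n + k)" "\<lambda>k. B (n + k)"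
    by (rule digit_sequence_shift)
  have "tail_char n \<xi> = T.tail_char 0 \<xi>"
    by (simp add: tail_char_def T.tail_char_def)
  also have "\<dots> = mask_poly (B (Suc n)) (\<xi> / N (Suc n)) * T.tail_char 1 (\<xi> / N (Suc n))"
    by (subst T.tail_char_0_eq[of _ 1]) simp
  also have "T.tail_char 1 = tail_char (Suc n)"
    by (simp add: fun_eq_iff tail_char_def T.tail_char_def)
  finally show ?thesis .
qed

end

locale hadamard_sequence =
  fixes N :: "nat \<Rightarrow> nat" and B L :: "nat \<Rightarrow> int set"
  assumes hadamard: "k \<ge> 1 \<Longrightarrow> hadamard_triple (N k) (B k) (L k)"
    and digits: "k \<ge> 1 \<Longrightarrow> B k \<subseteq> {0..int (N k) - 1}"
begin

sublocale digit_sequence N B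
  by standard (use hadamard digits in \<open>auto simp: hadamard_triple_def\<close>)

lemma equipositive:
  assumes "m \<ge> 1"
  obtains \<epsilon> where "\<epsilon> > 0" "\<epsilon> \<le> 1 / 2"
    "\<And>n x. card (B (Suc n)) \<le> m \<Longrightarrow> \<exists>k::int. \<epsilon> \<le> cmod (tail_char n (x + of_int k))"
proof
  \<comment> \<open>\<open>a\<close> bounds \<open>\<bar>\<eta>\<bar> * (N - 1)\<close> in the case
    of a small base, \<open>b\<close> is the margin supplied by
    \<open>hadamard_triple_large_value\<close> for a large base; both are below
    \<open>1 / 2\<close>, so their cosines are positive.\<close>
  define a where "a = 1 / 2 - 1 / (8 * real m)"
  define b where "b = 1 / 2 - 1 / (4 * real m)"
  have ab: "0 < a" "a < 1 / 2" "0 < b" "b < 1 / 2"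
    using assms by (auto simp: a_def b_def field_simps)
  have cos_pos: "cos (pi * t) > 0" if "0 < t" "t < 1 / 2" for t
    using that by (intro cos_gt_zero_pi) (auto intro: less_le_trans[of _ 0])
  \<comment> \<open>The last two terms belong to the cases of small and large base. The term
    \<open>1 / 2\<close> keeps \<open>\<epsilon>\<close> at most \<open>cos (pi / 3)\<close>, which
    \<open>spectral_level_good_extension\<close> relies on.\<close>
  define \<epsilon> where "\<epsilon> = min (1 / 2) (min (cos (pi * a) * cos (pi * (1 / 4))) (1 / (real m * 2 ^ m) * cos (pi * b)))"
  show "\<epsilon> > 0"
    using assms ab cos_pos[of "1 / 4"] by (auto simp: \<epsilon>_def intro!: mult_pos_pos divide_pos_pos cos_pos)
  show "\<epsilon> \<le> 1 / 2" unfolding \<epsilon>_def by (rule min.cobounded1)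
  fix n x assume card: "card (B (Suc n)) \<le> m"
  let ?N = "N (Suc n)" and ?B = "B (Suc n)"
  have N2: "?N \<ge> 2" using N_ge_2 by simp
  show "\<exists>k::int. \<epsilon> \<le> cmod (tail_char n (x + of_int k))"
  proof (cases "4 * m \<le> ?N")
    case True
    obtain k :: int where k: "\<bar>(x + of_int k) / ?N\<bar> \<le> b"
      and big: "1 / (real m * 2 ^ m) \<le> cmod (mask_poly ?B ((x + of_int k) / ?N))"
      using hadamard_triple_large_value[OF hadamard card True] unfolding b_def by auto
    have "1 / (real m * 2 ^ m) * cos (pi * b)
        \<le> cmod (mask_poly ?B ((x + of_int k) / ?N)) * cmod (tail_char (Suc n) ((x + of_int k) / ?N))"
      using big k ab cos_pos[of b] by (intro mult_mono tail_char_lower_bound) auto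
    then have "\<epsilon> \<le> cmod (tail_char n (x + of_int k))"
      by (subst tail_char_Suc) (auto simp: \<epsilon>_def norm_mult)
    then show ?thesis ..
  next
    case False
    define k where "k = - round x"
    have half: "\<bar>x + of_int k\<bar> \<le> 1 / 2"
      using of_int_round_abs_le[of x] unfolding k_def by (simp add: abs_minus_commute)
    have quarter: "\<bar>(x + of_int k) / ?N\<bar> \<le> 1 / 4"
    proof -
      have "\<bar>x + of_int k\<bar> / ?N \<le> (1 / 2) / 2"
        using half N2 by (intro frac_le) auto
      then show ?thesis by simp
    qed
    have "\<bar>(x + of_int k) / ?N\<bar> * (real ?N - 1) = \<bar>x + of_int k\<bar> * (1 - 1 / ?N)"
      using N2 by (simp add: field_simps)
    \<comment> \<open>A base below \<open>4 * m\<close> turns the factor \<open>1 - 1 / N\<close>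
      into a bound uniform in \<open>n\<close>.\<close>
    also have "\<dots> \<le> (1 / 2) * (1 - 1 / (4 * real m))"
    proof (intro mult_mono half)
      have "real ?N \<le> 4 * real m" using False by linarith
      then have "1 / (4 * real m) \<le> 1 / real ?N" using N2 by (intro divide_left_mono) auto
      then show "1 - 1 / real ?N \<le> 1 - 1 / (4 * real m)" by simp
      show "0 \<le> 1 - 1 / real ?N" using N2 by simp
    qed simp
    also have "\<dots> = a" by (simp add: a_def field_simps)
    finally have "cos (pi * a) \<le> cmod (mask_poly ?B ((x + of_int k) / ?N))"
      using N2 ab B_nonempty B_digits by (intro mask_poly_lower_bound[where N = ?N]) auto
    then have "cos (pi * a) * cos (pi * (1 / 4))
        \<le> cmod (mask_poly ?B ((x + of_int k) / ?N)) * cmod (tail_char (Suc n) ((x + of_int k) / ?N))"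
      using quarter cos_pos[of "1 / 4"] by (intro mult_mono tail_char_lower_bound) auto
    then have "\<epsilon> \<le> cmod (tail_char n (x + of_int k))"
      by (subst tail_char_Suc) (auto simp: \<epsilon>_def norm_mult)
    then show ?thesis ..
  qed
qed

end


section \<open>Spectra of the finite convolutions\<close>

context hadamard_sequence
begin

text \<open>By the case \<open>\<xi> = - \<gamma>'\<close> (see \<open>spectral_level_orthogonal\<close>), this says that \<open>\<Gamma>\<close> is a spectrum of the
  convolution of the first \<open>n\<close> factors.\<close>

definition spectral_level :: "nat \<Rightarrow> int set \<Rightarrow> bool" where
  "spectral_level n \<Gamma> \<longleftrightarrow> finite \<Gamma> \<and>
     (\<forall>\<xi>. (\<Sum>\<gamma>\<in>\<Gamma>. (cmod (mask_poly_prod N B n (\<xi> + of_int \<gamma>)))\<^sup>2) = 1)"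

lemma mask_poly_prod_at_0: "mask_poly_prod N B n 0 = 1"
  unfolding mask_poly_prod_def using B_finite B_nonempty by (intro prod.neutral) auto

text \<open>Every \<open>base_prod N i\<close> with \<open>i \<le> n\<close> divides
  \<open>base_prod N n\<close>, and each mask polynomial has period 1.\<close>

lemma mask_poly_prod_periodic:
  assumes "int (base_prod N n) dvd k"
  shows "mask_poly_prod N B n (\<xi> + of_int k) = mask_poly_prod N B n \<xi>"
  unfolding mask_poly_prod_def
proof (intro prod.cong refl)
  fix i assume "i \<in> {1..n}"
  then have "n = i + (n - i)" by simp
  then have "base_prod N i dvd base_prod N n" by (metis base_prod_add dvd_triv_left)
  with assms have "int (base_prod N i) dvd k" by (meson dvd_trans int_dvd_int_iff)
  then obtain q where "k = int (base_prod N i) * q" ..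
  then have "(\<xi> + of_int k) / base_prod N i = \<xi> / base_prod N i + of_int q"
    using base_prod_pos[of i] by (simp add: field_simps)
  then show "mask_poly (B i) ((\<xi> + of_int k) / base_prod N i) = mask_poly (B i) (\<xi> / base_prod N i)"
    by (simp add: mask_poly_add_int)
qed

lemma spectral_level_0: "spectral_level 0 {0}"
  by (simp add: spectral_level_def)

text \<open>At \<open>\<xi> = - \<gamma>'\<close> the term of \<open>\<gamma>'\<close> is already 1,
  so the other nonnegative terms vanish.\<close>

lemma spectral_level_orthogonal:
  assumes "spectral_level n \<Gamma>" "\<gamma> \<in> \<Gamma>" "\<gamma>' \<in> \<Gamma>" "\<gamma> \<noteq> \<gamma>'"
  shows "mask_poly_prod N B n (of_int (\<gamma> - \<gamma>')) = 0"
proof -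
  let ?f = "\<lambda>\<gamma>. (cmod (mask_poly_prod N B n (- of_int \<gamma>' + of_int \<gamma>)))\<^sup>2"
  have fin: "finite \<Gamma>" and sum: "sum ?f \<Gamma> = 1"
    using assms(1) unfolding spectral_level_def by blast+
  have "sum ?f \<Gamma> = ?f \<gamma>' + sum ?f (\<Gamma> - {\<gamma>'})"
    using fin assms by (intro sum.remove) auto
  with sum have "sum ?f (\<Gamma> - {\<gamma>'}) = 0"
    by (simp add: mask_poly_prod_at_0)
  then have "?f \<gamma> = 0"
    using fin assms by (subst (asm) sum_nonneg_eq_0_iff) auto
  then show ?thesis by (simp add: algebra_simps)
qed

text \<open>For congruent elements periodicity gives the value 1 where orthogonality gives
  0.\<close>

lemma spectral_level_not_congruent:
  assumes "spectral_level n \<Gamma>" "\<gamma> \<in> \<Gamma>" "\<gamma>' \<in> \<Gamma>" "int (base_prod N n) dvd \<gamma> - \<gamma>'"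
  shows "\<gamma> = \<gamma>'"
proof (rule ccontr)
  assume "\<gamma> \<noteq> \<gamma>'"
  with assms have "mask_poly_prod N B n (of_int (\<gamma> - \<gamma>')) = 0"
    by (intro spectral_level_orthogonal)
  moreover have "mask_poly_prod N B n (0 + of_int (\<gamma> - \<gamma>')) = 1"
    using mask_poly_prod_periodic[OF assms(4), of 0] by (simp add: mask_poly_prod_at_0)
  ultimately show False by simp
qed

text \<open>Elementwise translation by periods changes no term of the sum, and it merges no two
  elements because distinct elements are incongruent.\<close>

lemma spectral_level_translate:
  assumes \<Gamma>: "spectral_level n \<Gamma>" and f: "\<And>\<gamma>. \<gamma> \<in> \<Gamma> \<Longrightarrow> int (base_prod N n) dvd f \<gamma> - \<gamma>"
  shows "spectral_level n (f ` \<Gamma>)"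
proof -
  have inj: "inj_on f \<Gamma>"
  proof (rule inj_onI)
    fix \<gamma> \<gamma>' assume *: "\<gamma> \<in> \<Gamma>" "\<gamma>' \<in> \<Gamma>" "f \<gamma> = f \<gamma>'"
    have "int (base_prod N n) dvd (f \<gamma>' - \<gamma>') - (f \<gamma> - \<gamma>)"
      by (rule dvd_diff[OF f[OF *(2)] f[OF *(1)]])
    with * have "int (base_prod N n) dvd \<gamma> - \<gamma>'" by simp
    with * show "\<gamma> = \<gamma>'" by (intro spectral_level_not_congruent[OF \<Gamma>])
  qed
  have "mask_poly_prod N B n (\<xi> + of_int (f \<gamma>)) = mask_poly_prod N B n (\<xi> + of_int \<gamma>)" if "\<gamma> \<in> \<Gamma>" for \<xi> \<gamma>
    using mask_poly_prod_periodic[OF f[OF that], of "\<xi> + of_int \<gamma>"] by (simp add: algebra_simps)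
  with \<Gamma> show ?thesis
    by (simp add: spectral_level_def sum.reindex[OF inj])
qed

text \<open>Every \<open>\<gamma>\<close> branches into
  \<open>\<gamma> + base_prod N n * (l - l0)\<close> with \<open>l\<close> in
  \<open>L (Suc n)\<close>. The branches share the first \<open>n\<close> factors by periodicity,
  and the new factor sums to 1 over \<open>l\<close> by \<open>hadamard_triple_sum\<close>.\<close>

lemma spectral_level_step:
  assumes \<Gamma>: "spectral_level n \<Gamma>"
  obtains \<Gamma>' where "\<Gamma> \<subseteq> \<Gamma>'" "spectral_level (Suc n) \<Gamma>'"
proof -
  let ?P = "base_prod N n" and ?N = "N (Suc n)" and ?B = "B (Suc n)" and ?L = "L (Suc n)"
  have H: "hadamard_triple ?N ?B ?L" by (simp add: hadamard)
  then have fin: "finite ?L" and ne: "?L \<noteq> {}" by (auto simp: hadamard_triple_def)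
  from ne obtain l0 where l0: "l0 \<in> ?L" by blast
  \<comment> \<open>Subtracting \<open>l0\<close> makes the branch \<open>l = l0\<close> equal to
    \<open>\<gamma>\<close> itself, so that the old set is contained in the new one.\<close>
  define f where "f = (\<lambda>(\<gamma>, l). \<gamma> + int ?P * (l - l0))"
  have P: "?P > 0" and N: "?N > 0" using base_prod_pos N_ge_2[of "Suc n"] by auto
  have inj: "inj_on f (\<Gamma> \<times> ?L)"
  proof (rule inj_onI, clarify)
    fix \<gamma> l \<gamma>' l' assume *: "\<gamma> \<in> \<Gamma>" "\<gamma>' \<in> \<Gamma>" "f (\<gamma>, l) = f (\<gamma>', l')"
    then have "\<gamma> - \<gamma>' = int ?P * (l' - l)" by (simp add: f_def algebra_simps)
    then have "\<gamma> = \<gamma>'" using * by (intro spectral_level_not_congruent[OF \<Gamma>]) auto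
    with * P show "\<gamma> = \<gamma>' \<and> l = l'" by (simp add: f_def)
  qed
  have sum1: "(\<Sum>\<gamma>\<in>f ` (\<Gamma> \<times> ?L). (cmod (mask_poly_prod N B (Suc n) (\<xi> + of_int \<gamma>)))\<^sup>2) = 1" for \<xi>
  proof -
    have "(\<Sum>\<gamma>\<in>f ` (\<Gamma> \<times> ?L). (cmod (mask_poly_prod N B (Suc n) (\<xi> + of_int \<gamma>)))\<^sup>2)
        = (\<Sum>\<gamma>\<in>\<Gamma>. \<Sum>l\<in>?L. (cmod (mask_poly_prod N B (Suc n) (\<xi> + of_int (f (\<gamma>, l)))))\<^sup>2)"
      by (simp add: sum.reindex[OF inj] sum.cartesian_product case_prod_beta)
    also have "\<dots> = (\<Sum>\<gamma>\<in>\<Gamma>. (cmod (mask_poly_prod N B n (\<xi> + of_int \<gamma>)))\<^sup>2)"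
    proof (intro sum.cong refl)
      fix \<gamma>
      \<comment> \<open>The shift by \<open>l0\<close> is absorbed here;
        \<open>hadamard_triple_sum\<close> holds at every real point.\<close>
      define \<eta> where "\<eta> = ((\<xi> + of_int \<gamma>) / ?P - of_int l0) / ?N"
      have "(cmod (mask_poly_prod N B (Suc n) (\<xi> + of_int (f (\<gamma>, l)))))\<^sup>2
          = (cmod (mask_poly_prod N B n (\<xi> + of_int \<gamma>)))\<^sup>2 * (cmod (mask_poly ?B (\<eta> + of_int l / ?N)))\<^sup>2" for l
      proof -
        have "mask_poly_prod N B n (\<xi> + of_int (f (\<gamma>, l))) = mask_poly_prod N B n (\<xi> + of_int \<gamma>)"
          using mask_poly_prod_periodic[of n "int ?P * (l - l0)" "\<xi> + of_int \<gamma>"]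
          by (simp add: f_def algebra_simps)
        moreover have "(\<xi> + of_int (f (\<gamma>, l))) / base_prod N (Suc n) = \<eta> + of_int l / ?N"
          using P N by (simp add: f_def \<eta>_def field_simps)
        ultimately show ?thesis
          by (simp only: mask_poly_prod_Suc norm_mult power_mult_distrib)
      qed
      then show "(\<Sum>l\<in>?L. (cmod (mask_poly_prod N B (Suc n) (\<xi> + of_int (f (\<gamma>, l)))))\<^sup>2)
          = (cmod (mask_poly_prod N B n (\<xi> + of_int \<gamma>)))\<^sup>2"
        by (simp only: sum_distrib_left[symmetric] hadamard_triple_sum[OF H] mult_1_right)
    qed
    finally show ?thesis using \<Gamma> by (simp add: spectral_level_def)
  qed
  show thesis
  proof (rule that)
    show "\<Gamma> \<subseteq> f ` (\<Gamma> \<times> ?L)"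
      using l0 by (force simp: f_def image_iff)
    show "spectral_level (Suc n) (f ` (\<Gamma> \<times> ?L))"
      using \<Gamma> fin sum1 by (simp add: spectral_level_def)
  qed
qed

lemma spectral_level_extend:
  assumes "spectral_level n \<Gamma>" "n \<le> n'"
  obtains \<Gamma>' where "\<Gamma> \<subseteq> \<Gamma>'" "spectral_level n' \<Gamma>'"
proof -
  have "\<exists>\<Gamma>'. \<Gamma> \<subseteq> \<Gamma>' \<and> spectral_level n' \<Gamma>'"
    using assms(2)
  proof (induction n' rule: dec_induct)
    case base
    with assms(1) show ?case by blast
  next
    case (step k)
    then obtain \<Gamma>' where "\<Gamma> \<subseteq> \<Gamma>'" "spectral_level k \<Gamma>'" by blast
    then show ?case by (meson spectral_level_step subset_trans)
  qed
  with that show thesis by blast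
qed

text \<open>Elements of \<open>\<Gamma>\<close> stay fixed for the sake of nesting; after rescaling
  they are at most \<open>1 / 3\<close>, where the cosine bound gives
  \<open>1 / 2 \<ge> \<epsilon>\<close>. The new elements are free to move by multiples of
  \<open>base_prod N n'\<close>, which are integer shifts of the rescaled argument, to a point where
  the tail is large.\<close>

lemma spectral_level_good_extension:
  assumes "spectral_level n \<Gamma>" "n \<le> n'"
    and small: "\<And>\<gamma>. \<gamma> \<in> \<Gamma> \<Longrightarrow> \<bar>of_int \<gamma> / base_prod N n'\<bar> \<le> 1 / 3"
    and \<epsilon>: "\<epsilon> \<le> 1 / 2" "\<And>x. \<exists>k::int. \<epsilon> \<le> cmod (tail_char n' (x + of_int k))"
  obtains \<Gamma>' where "\<Gamma> \<subseteq> \<Gamma>'" "spectral_level n' \<Gamma>'"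
    "\<And>\<gamma>. \<gamma> \<in> \<Gamma>' \<Longrightarrow> \<epsilon> \<le> cmod (tail_char n' (of_int \<gamma> / base_prod N n'))"
proof -
  let ?P = "base_prod N n'"
  have P: "?P > 0" by (rule base_prod_pos)
  obtain \<Delta> where \<Delta>: "\<Gamma> \<subseteq> \<Delta>" "spectral_level n' \<Delta>"
    using spectral_level_extend[OF assms(1,2)] .
  obtain k :: "real \<Rightarrow> int" where k: "\<And>x. \<epsilon> \<le> cmod (tail_char n' (x + of_int (k x)))"
    using \<epsilon>(2) by metis
  define f where "f \<gamma> = (if \<gamma> \<in> \<Gamma> then \<gamma> else \<gamma> + int ?P * k (of_int \<gamma> / ?P))" for \<gamma>
  show thesis
  proof (rule that)
    have "\<gamma> \<in> f ` \<Delta>" if "\<gamma> \<in> \<Gamma>" for \<gamma>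
      using that \<Delta> by (intro image_eqI[of _ f \<gamma>]) (auto simp: f_def)
    then show "\<Gamma> \<subseteq> f ` \<Delta>" by blast
    show "spectral_level n' (f ` \<Delta>)"
      by (rule spectral_level_translate[OF \<Delta>(2)]) (simp add: f_def)
    fix \<delta> assume "\<delta> \<in> f ` \<Delta>"
    then obtain \<gamma> where \<gamma>: "\<delta> = f \<gamma>" by blast
    show "\<epsilon> \<le> cmod (tail_char n' (of_int \<delta> / ?P))"
    proof (cases "\<gamma> \<in> \<Gamma>")
      case True
      have "cos (pi * (1 / 3)) \<le> cmod (tail_char n' (of_int \<gamma> / ?P))"
        by (rule tail_char_lower_bound) (use small True in auto)
      with True \<epsilon> show ?thesis by (simp add: \<gamma> f_def cos_60)
    next
      case False
      then have "of_int \<delta> / ?P = of_int \<gamma> / ?P + real_of_int (k (of_int \<gamma> / ?P))"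
        using P by (simp add: \<gamma> f_def field_simps)
      then show ?thesis using k by simp
    qed
  qed
qed

text \<open>Dependent choice starting from level 0 and \<open>{0}\<close>. As the current set is
  finite, a later level makes its rescaled elements small, and such a level with at most
  \<open>m\<close> digits exists by \<open>freq\<close>.\<close>

lemma spectral_levels_exist:
  assumes "m \<ge> 1" and freq: "\<And>n0. \<exists>n\<ge>n0. card (B (Suc n)) \<le> m"
  obtains \<epsilon> :: real and n :: "nat \<Rightarrow> nat" and \<Gamma> :: "nat \<Rightarrow> int set"
  where "\<epsilon> > 0" "strict_mono n" "mono \<Gamma>" "\<And>j. spectral_level (n j) (\<Gamma> j)"
    "\<And>j \<gamma>. \<gamma> \<in> \<Gamma> j \<Longrightarrow> \<epsilon> \<le> cmod (tail_char (n j) (of_int \<gamma> / base_prod N (n j)))"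
proof -
  obtain \<epsilon> where \<epsilon>: "\<epsilon> > 0" "\<epsilon> \<le> 1 / 2"
    "\<And>n x. card (B (Suc n)) \<le> m \<Longrightarrow> \<exists>k::int. \<epsilon> \<le> cmod (tail_char n (x + of_int k))"
    using equipositive[OF assms(1)] by blast
  define Q where "Q = (\<lambda>(n, \<Gamma>). spectral_level n \<Gamma> \<and>
    (\<forall>\<gamma>\<in>\<Gamma>. \<epsilon> \<le> cmod (tail_char n (of_int \<gamma> / base_prod N n))))"
  have "\<exists>f. \<forall>j. Q (f j) \<and> (fst (f j) < fst (f (Suc j)) \<and> snd (f j) \<subseteq> snd (f (Suc j)))"
  proof (rule dependent_nat_choice)
    have "Q (0, {0})"
      using \<epsilon> by (simp add: Q_def spectral_level_0 tail_char_0_at_0)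
    then show "\<exists>x. Q x" ..
    fix x :: "nat \<times> int set" and j :: nat
    assume Qx: "Q x"
    obtain n \<Gamma> where x: "x = (n, \<Gamma>)" by (cases x)
    with Qx have \<Gamma>: "spectral_level n \<Gamma>" by (simp add: Q_def)
    then have fin: "finite \<Gamma>" by (simp add: spectral_level_def)
    \<comment> \<open>The inserted 0 guarantees that the maximum is over a nonempty set.\<close>
    define K where "K = Max (insert 0 ((\<lambda>\<gamma>. 3 * \<bar>real_of_int \<gamma>\<bar>) ` \<Gamma>))"
    have "\<forall>\<^sub>F n' in sequentially. K \<le> real (base_prod N n')"
      using filterlim_base_prod by (auto simp: filterlim_at_top)
    then obtain n0 where n0: "\<And>n'. n' \<ge> n0 \<Longrightarrow> K \<le> real (base_prod N n')"
      by (auto simp: eventually_sequentially)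
    obtain n' where n': "n' \<ge> max n0 (Suc n)" "card (B (Suc n')) \<le> m"
      using freq by blast
    have small: "\<bar>of_int \<gamma> / base_prod N n'\<bar> \<le> 1 / 3" if "\<gamma> \<in> \<Gamma>" for \<gamma>
    proof -
      have "3 * \<bar>real_of_int \<gamma>\<bar> \<le> K"
        unfolding K_def using fin that by (intro Max_ge) auto
      also have "K \<le> real (base_prod N n')" using n0 n' by simp
      finally show ?thesis using base_prod_pos[of n'] by (simp add: field_simps)
    qed
    have "n \<le> n'" using n' by simp
    obtain \<Gamma>' where "\<Gamma> \<subseteq> \<Gamma>'" "spectral_level n' \<Gamma>'"
      "\<And>\<gamma>. \<gamma> \<in> \<Gamma>' \<Longrightarrow> \<epsilon> \<le> cmod (tail_char n' (of_int \<gamma> / base_prod N n'))"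
      using spectral_level_good_extension[OF \<Gamma> \<open>n \<le> n'\<close> small \<epsilon>(2) \<epsilon>(3)[OF n'(2)]] by blast
    then show "\<exists>y. Q y \<and> (fst x < fst y \<and> snd x \<subseteq> snd y)"
      using n' by (intro exI[of _ "(n', \<Gamma>')"]) (auto simp: Q_def x)
  qed
  then obtain f where f: "\<And>j. Q (f j)" "\<And>j. fst (f j) < fst (f (Suc j))" "\<And>j. snd (f j) \<subseteq> snd (f (Suc j))"
    by blast
  show thesis
  proof (rule that[of \<epsilon> "fst \<circ> f" "snd \<circ> f"])
    show "strict_mono (fst \<circ> f)" using f by (simp add: strict_mono_Suc_iff)
    show "mono (snd \<circ> f)" using f by (simp add: mono_iff_le_Suc)
  qed (use \<epsilon> f in \<open>auto simp: Q_def case_prod_beta\<close>)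
qed

text \<open>Dominated convergence in the form \<open>1 \<le> s\<^sub>i + C (S - s\<^sub>i)\<close>, where \<open>s\<^sub>i\<close> are the partial sums
  with limit \<open>S\<close>: the lower bound on the tail controls the terms outside of \<open>\<Gamma> i\<close> by those of
  the limiting series.\<close>

lemma tail_char_parseval:
  assumes \<epsilon>: "\<epsilon> > 0" and n: "strict_mono n" and \<Gamma>: "mono \<Gamma>" "\<And>j. spectral_level (n j) (\<Gamma> j)"
    and lower: "\<And>j \<gamma>. \<gamma> \<in> \<Gamma> j \<Longrightarrow> \<epsilon> \<le> cmod (tail_char (n j) (of_int \<gamma> / base_prod N (n j)))"
  shows "(\<lambda>j. \<Sum>\<gamma>\<in>\<Gamma> j. (cmod (tail_char 0 (\<xi> + of_int \<gamma>)))\<^sup>2) \<longlonglongrightarrow> 1"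
proof -
  define a where "a \<gamma> = (cmod (tail_char 0 (\<xi> + of_int \<gamma>)))\<^sup>2" for \<gamma> :: int
  define b where "b j \<gamma> = (cmod (mask_poly_prod N B (n j) (\<xi> + of_int \<gamma>)))\<^sup>2" for j and \<gamma> :: int
  define s where "s j = sum a (\<Gamma> j)" for j
  \<comment> \<open>The inverse of the square of \<open>\<epsilon> / 2\<close>, the lower bound for
    the tail at the arguments shifted by \<open>\<xi>\<close>.\<close>
  define C where "C = 4 / \<epsilon>\<^sup>2"
  have fin: "finite (\<Gamma> j)" and b1: "sum (b j) (\<Gamma> j) = 1" for j
    using \<Gamma>(2)[of j] by (auto simp: spectral_level_def b_def)
  have a0: "a \<gamma> \<ge> 0" and b0: "b j \<gamma> \<ge> 0" for j \<gamma> by (simp_all add: a_def b_def)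
  have ab: "a \<gamma> = b j \<gamma> * (cmod (tail_char (n j) ((\<xi> + of_int \<gamma>) / base_prod N (n j))))\<^sup>2" for j \<gamma>
    by (simp add: a_def b_def tail_char_0_eq[of _ "n j"] norm_mult power_mult_distrib)
  have "a \<gamma> \<le> b j \<gamma> * 1" for j \<gamma>
    unfolding ab[of _ j] using norm_tail_char_le_1 b0 by (intro mult_left_mono power_le_one) auto
  then have s_le: "s j \<le> 1" for j
    using sum_mono[of "\<Gamma> j" a "b j"] b1[of j] by (simp add: s_def)
  have s_mono: "mono s"
    unfolding s_def using \<Gamma>(1) fin a0 by (auto intro!: monoI sum_mono2 dest: monoD)
  obtain S where S: "s \<longlonglongrightarrow> S"
    using incseq_convergent[of s 1] s_mono s_le by blast
  have lim_b: "(\<lambda>j. b j \<gamma>) \<longlonglongrightarrow> a \<gamma>" for \<gamma>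
    unfolding a_def b_def
    using LIMSEQ_subseq_LIMSEQ[OF mask_poly_prod_tendsto n] by (intro tendsto_intros) (simp add: comp_def)
  \<comment> \<open>The frequency \<open>\<xi>\<close> moves the rescaled argument by
    \<open>\<xi> / base_prod N (n j)\<close>. By the Lipschitz bound this eventually costs at most
    half of \<open>\<epsilon>\<close>.\<close>
  have ev: "\<forall>\<^sub>F j in sequentially. 2 * pi * \<bar>\<xi>\<bar> / base_prod N (n j) \<le> \<epsilon> / 2"
  proof -
    have "filterlim (\<lambda>j. real (base_prod N (n j))) at_top sequentially"
      using filterlim_compose[OF filterlim_base_prod filterlim_subseq[OF n]] .
    then have "(\<lambda>j. 2 * pi * \<bar>\<xi>\<bar> / base_prod N (n j)) \<longlonglongrightarrow> 0"
      by (intro tendsto_divide_0[OF tendsto_const] filterlim_at_top_imp_at_infinity)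
    then have "\<forall>\<^sub>F j in sequentially. 2 * pi * \<bar>\<xi>\<bar> / base_prod N (n j) < \<epsilon> / 2"
      by (rule order_tendstoD) (use \<epsilon> in simp)
    then show ?thesis by (rule eventually_mono) simp
  qed
  have bound: "b j \<gamma> \<le> C * a \<gamma>"
    if j: "2 * pi * \<bar>\<xi>\<bar> / base_prod N (n j) \<le> \<epsilon> / 2" and \<gamma>: "\<gamma> \<in> \<Gamma> j" for j \<gamma>
  proof -
    let ?P = "base_prod N (n j)"
    have P: "?P > 0" by (rule base_prod_pos)
    have "cmod (tail_char (n j) (of_int \<gamma> / ?P)) - cmod (tail_char (n j) ((\<xi> + of_int \<gamma>) / ?P))
        \<le> cmod (tail_char (n j) (of_int \<gamma> / ?P) - tail_char (n j) ((\<xi> + of_int \<gamma>) / ?P))"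
      by (rule norm_triangle_ineq2)
    also have "\<dots> \<le> 2 * pi * \<bar>of_int \<gamma> / ?P - (\<xi> + of_int \<gamma>) / ?P\<bar>"
      by (rule tail_char_diff_le)
    also have "of_int \<gamma> / ?P - (\<xi> + of_int \<gamma>) / ?P = - (\<xi> / ?P)"
      by (simp add: add_divide_distrib)
    also have "2 * pi * \<bar>- (\<xi> / ?P)\<bar> = 2 * pi * \<bar>\<xi>\<bar> / ?P" by simp
    also note j
    finally have "\<epsilon> / 2 \<le> cmod (tail_char (n j) ((\<xi> + of_int \<gamma>) / ?P))"
      using lower[OF \<gamma>] by simp
    then have "(\<epsilon> / 2)\<^sup>2 \<le> (cmod (tail_char (n j) ((\<xi> + of_int \<gamma>) / ?P)))\<^sup>2"
      using \<epsilon> by (intro power_mono) auto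
    then have "b j \<gamma> * (\<epsilon> / 2)\<^sup>2 \<le> a \<gamma>"
      unfolding ab[of _ j] using b0 by (intro mult_left_mono) auto
    then show ?thesis
      using \<epsilon> by (simp add: C_def field_simps power2_eq_square)
  qed
  \<comment> \<open>Here \<open>i\<close> is fixed and \<open>j\<close> grows: the finite sum over
    \<open>\<Gamma> i\<close> converges termwise, while the terms in
    \<open>\<Gamma> j - \<Gamma> i\<close> are bounded by \<open>C\<close> times those of the
    limiting series. Afterwards \<open>i\<close> tends to infinity.\<close>
  have step: "1 \<le> s i + C * (S - s i)" for i
  proof (rule tendsto_le[OF sequentially_bot _ tendsto_const])
    show "(\<lambda>j. sum (b j) (\<Gamma> i) + C * (s j - s i)) \<longlonglongrightarrow> s i + C * (S - s i)"
      unfolding s_def[of i] by (intro tendsto_intros lim_b S)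
    show "\<forall>\<^sub>F j in sequentially. 1 \<le> sum (b j) (\<Gamma> i) + C * (s j - s i)"
      using ev eventually_ge_at_top[of i]
    proof eventually_elim
      case (elim j)
      have sub: "\<Gamma> i \<subseteq> \<Gamma> j" using \<Gamma>(1) elim by (auto dest: monoD)
      have "1 = sum (b j) (\<Gamma> i) + sum (b j) (\<Gamma> j - \<Gamma> i)"
        using b1[of j] sum.subset_diff[OF sub fin, of "b j"] by simp
      also have "sum (b j) (\<Gamma> j - \<Gamma> i) \<le> (\<Sum>\<gamma>\<in>\<Gamma> j - \<Gamma> i. C * a \<gamma>)"
        using elim by (intro sum_mono bound) auto
      also have "\<dots> = C * (s j - s i)"
        using sum.subset_diff[OF sub fin, of a] by (simp add: s_def sum_distrib_left[symmetric])
      finally show ?case by simp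
    qed
  qed
  have "(\<lambda>i. s i + C * (S - s i)) \<longlonglongrightarrow> S + C * (S - S)"
    by (intro tendsto_add tendsto_mult tendsto_diff tendsto_const S)
  then have "1 \<le> S + C * (S - S)"
    using step by (intro LIMSEQ_le_const) auto
  moreover have "S \<le> 1"
    using S s_le by (intro LIMSEQ_le_const2) auto
  ultimately have "S = 1" by simp
  with S show ?thesis by (simp add: s_def[abs_def] a_def[abs_def])
qed

end


section \<open>Density of exponentials\<close>

lemma cmod_power2_add_le: "(cmod (a + b))\<^sup>2 \<le> 2 * (cmod a)\<^sup>2 + 2 * (cmod b)\<^sup>2"
proof -
  have "(cmod (a + b))\<^sup>2 \<le> (cmod a + cmod b)\<^sup>2"
    by (intro power_mono norm_triangle_ineq) simp
  also have "\<dots> \<le> 2 * (cmod a)\<^sup>2 + 2 * (cmod b)\<^sup>2"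
    using sum_squares_bound[of "cmod a" "cmod b"] by (simp add: power2_sum)
  finally show ?thesis .
qed

lemma L2_functions_add:
  assumes "f \<in> L2_functions M" "g \<in> L2_functions M"
  shows "(\<lambda>x. f x + g x) \<in> L2_functions M"
proof -
  have [measurable]: "f \<in> borel_measurable M" "g \<in> borel_measurable M"
    using assms by (auto simp: L2_functions_def)
  have "integrable M (\<lambda>x. (cmod (f x + g x))\<^sup>2)"
  proof (rule Bochner_Integration.integrable_bound)
    show "integrable M (\<lambda>x. 2 * (cmod (f x))\<^sup>2 + 2 * (cmod (g x))\<^sup>2)"
      using assms by (auto simp: L2_functions_def)
    show "AE x in M. norm ((cmod (f x + g x))\<^sup>2) \<le> norm (2 * (cmod (f x))\<^sup>2 + 2 * (cmod (g x))\<^sup>2)"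
      using cmod_power2_add_le by (auto intro!: AE_I2)
  qed simp
  then show ?thesis by (simp add: L2_functions_def)
qed

lemma L2_functions_scale: "f \<in> L2_functions M \<Longrightarrow> (\<lambda>x. c * f x) \<in> L2_functions M"
  by (auto simp: L2_functions_def norm_mult power_mult_distrib)

lemma L2_functions_diff:
  assumes "f \<in> L2_functions M" "g \<in> L2_functions M"
  shows "(\<lambda>x. f x - g x) \<in> L2_functions M"
  using L2_functions_add[OF assms(1) L2_functions_scale[OF assms(2), of "- 1"]] by simp

text \<open>A substitute for Minkowski's inequality; the factors 2 are harmless, since approximation
  errors may be taken as \<open>\<epsilon> / 4\<close>.\<close>

lemma L2_integral_add_le:
  assumes "f \<in> L2_functions M" "g \<in> L2_functions M"
  shows "(\<integral>x. (cmod (f x + g x))\<^sup>2 \<partial>M) \<le> 2 * (\<integral>x. (cmod (f x))\<^sup>2 \<partial>M) + 2 * (\<integral>x. (cmod (g x))\<^sup>2 \<partial>M)"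
proof -
  have int: "integrable M (\<lambda>x. (cmod (f x))\<^sup>2)" "integrable M (\<lambda>x. (cmod (g x))\<^sup>2)"
    using assms by (auto simp: L2_functions_def)
  have "(\<integral>x. (cmod (f x + g x))\<^sup>2 \<partial>M) \<le> (\<integral>x. 2 * (cmod (f x))\<^sup>2 + 2 * (cmod (g x))\<^sup>2 \<partial>M)"
  proof (rule integral_mono)
    show "integrable M (\<lambda>x. (cmod (f x + g x))\<^sup>2)"
      using L2_functions_add[OF assms] by (simp add: L2_functions_def)
    show "integrable M (\<lambda>x. 2 * (cmod (f x))\<^sup>2 + 2 * (cmod (g x))\<^sup>2)"
      using int by simp
  qed (rule cmod_power2_add_le)
  also have "\<dots> = 2 * (\<integral>x. (cmod (f x))\<^sup>2 \<partial>M) + 2 * (\<integral>x. (cmod (g x))\<^sup>2 \<partial>M)"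
    using int by simp
  finally show ?thesis .
qed

lemma (in finite_measure) bounded_in_L2_functions:
  assumes "f \<in> borel_measurable M" "\<And>x. cmod (f x) \<le> C"
  shows "f \<in> L2_functions M"
proof -
  have "integrable M (\<lambda>x. (cmod (f x))\<^sup>2)"
  proof (rule integrable_const_bound)
    show "AE x in M. norm ((cmod (f x))\<^sup>2) \<le> C\<^sup>2"
      using assms(2) by (auto intro!: AE_I2 power_mono)
  qed (use assms in measurable)
  with assms show ?thesis by (simp add: L2_functions_def)
qed

section \<open>Closure of a linear subspace of square-integrable functions\<close>

text \<open>\<open>V\<close> will be the span of the exponentials with frequencies in the candidate
  spectrum; completeness amounts to its closure \<open>cl\<close> being everything.\<close>

locale L2_subspace = real_distribution M for M :: "real measure" +
  fixes V :: "(real \<Rightarrow> complex) set"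
  assumes V_L2: "V \<subseteq> L2_functions M"
    and V_add: "f \<in> V \<Longrightarrow> g \<in> V \<Longrightarrow> (\<lambda>x. f x + g x) \<in> V"
    and V_scale: "f \<in> V \<Longrightarrow> (\<lambda>x. c * f x) \<in> V"
begin

definition cl :: "(real \<Rightarrow> complex) set" where
  "cl = {f \<in> L2_functions M. \<forall>\<epsilon>>0. \<exists>g\<in>V. (\<integral>x. (cmod (f x - g x))\<^sup>2 \<partial>M) < \<epsilon>}"

lemma cl_L2: "f \<in> cl \<Longrightarrow> f \<in> L2_functions M"
  by (simp add: cl_def)

lemma cl_add:
  assumes "f \<in> cl" "g \<in> cl"
  shows "(\<lambda>x. f x + g x) \<in> cl"
  unfolding cl_def
proof (intro CollectI conjI allI impI)
  show "(\<lambda>x. f x + g x) \<in> L2_functions M"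
    using assms by (intro L2_functions_add cl_L2)
  fix \<epsilon> :: real assume "\<epsilon> > 0"
  then have "\<epsilon> / 4 > 0" by simp
  then obtain f' g' where f': "f' \<in> V" "(\<integral>x. (cmod (f x - f' x))\<^sup>2 \<partial>M) < \<epsilon> / 4"
    and g': "g' \<in> V" "(\<integral>x. (cmod (g x - g' x))\<^sup>2 \<partial>M) < \<epsilon> / 4"
    using assms unfolding cl_def by blast
  have "(\<integral>x. (cmod ((f x - f' x) + (g x - g' x)))\<^sup>2 \<partial>M)
      \<le> 2 * (\<integral>x. (cmod (f x - f' x))\<^sup>2 \<partial>M) + 2 * (\<integral>x. (cmod (g x - g' x))\<^sup>2 \<partial>M)"
    using assms f' g' V_L2 by (intro L2_integral_add_le L2_functions_diff) (auto intro: cl_L2)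
  with f' g' have "(\<integral>x. (cmod ((f x - f' x) + (g x - g' x)))\<^sup>2 \<partial>M) < \<epsilon>"
    by simp
  then show "\<exists>h\<in>V. (\<integral>x. (cmod (f x + g x - h x))\<^sup>2 \<partial>M) < \<epsilon>"
    using V_add[OF f'(1) g'(1)] by (intro bexI[of _ "\<lambda>x. f' x + g' x"]) (auto simp: algebra_simps)
qed

lemma cl_scale:
  assumes "f \<in> cl"
  shows "(\<lambda>x. c * f x) \<in> cl"
  unfolding cl_def
proof (intro CollectI conjI allI impI)
  show "(\<lambda>x. c * f x) \<in> L2_functions M"
    using assms by (intro L2_functions_scale cl_L2)
  fix \<epsilon> :: real assume "\<epsilon> > 0"
  define \<delta> where "\<delta> = \<epsilon> / ((cmod c)\<^sup>2 + 1)"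
  have pos: "(cmod c)\<^sup>2 + 1 > 0" using zero_le_power2[of "cmod c"] by linarith
  with \<open>\<epsilon> > 0\<close> have "\<delta> > 0" by (simp add: \<delta>_def)
  then obtain f' where f': "f' \<in> V" "(\<integral>x. (cmod (f x - f' x))\<^sup>2 \<partial>M) < \<delta>"
    using assms unfolding cl_def by blast
  have "(\<integral>x. (cmod (c * f x - c * f' x))\<^sup>2 \<partial>M) = (cmod c)\<^sup>2 * (\<integral>x. (cmod (f x - f' x))\<^sup>2 \<partial>M)"
    by (simp add: right_diff_distrib[symmetric] norm_mult power_mult_distrib)
  also have "\<dots> \<le> (cmod c)\<^sup>2 * \<delta>"
    using f' by (intro mult_left_mono) auto
  also have "\<dots> < ((cmod c)\<^sup>2 + 1) * \<delta>"
    using \<open>\<delta> > 0\<close> by simp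
  also have "\<dots> = \<epsilon>" using pos by (simp add: \<delta>_def)
  finally show "\<exists>h\<in>V. (\<integral>x. (cmod (c * f x - h x))\<^sup>2 \<partial>M) < \<epsilon>"
    using V_scale[OF f'(1), of c] by (intro bexI[of _ "\<lambda>x. c * f' x"])
qed

lemma cl_limit:
  assumes "f \<in> L2_functions M" "\<And>\<epsilon>. \<epsilon> > 0 \<Longrightarrow> \<exists>g\<in>cl. (\<integral>x. (cmod (f x - g x))\<^sup>2 \<partial>M) < \<epsilon>"
  shows "f \<in> cl"
  unfolding cl_def
proof (intro CollectI conjI allI impI assms(1))
  fix \<epsilon> :: real assume "\<epsilon> > 0"
  then have e: "\<epsilon> / 4 > 0" by simp
  then obtain g where g: "g \<in> cl" "(\<integral>x. (cmod (f x - g x))\<^sup>2 \<partial>M) < \<epsilon> / 4"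
    using assms(2) by blast
  then obtain h where h: "h \<in> V" "(\<integral>x. (cmod (g x - h x))\<^sup>2 \<partial>M) < \<epsilon> / 4"
    using e unfolding cl_def by blast
  have "(\<integral>x. (cmod ((f x - g x) + (g x - h x)))\<^sup>2 \<partial>M)
      \<le> 2 * (\<integral>x. (cmod (f x - g x))\<^sup>2 \<partial>M) + 2 * (\<integral>x. (cmod (g x - h x))\<^sup>2 \<partial>M)"
    using assms(1) g h V_L2 by (intro L2_integral_add_le L2_functions_diff) (auto intro: cl_L2)
  with g h show "\<exists>h\<in>V. (\<integral>x. (cmod (f x - h x))\<^sup>2 \<partial>M) < \<epsilon>"
    by (intro bexI[of _ h]) auto
qed

text \<open>Domination turns pointwise convergence into convergence in mean square.\<close>

lemma cl_dominated_limit: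
  assumes f: "f \<in> L2_functions M" and s: "\<And>n. s n \<in> cl"
    and lim: "\<And>x. (\<lambda>n. s n x) \<longlonglongrightarrow> f x"
    and w: "integrable M w" "\<And>n x. (cmod (f x - s n x))\<^sup>2 \<le> w x"
  shows "f \<in> cl"
proof (rule cl_limit[OF f])
  fix \<epsilon> :: real assume "\<epsilon> > 0"
  have [measurable]: "f \<in> borel_measurable M" "\<And>n. s n \<in> borel_measurable M"
    using f cl_L2[OF s] by (auto simp: L2_functions_def)
  have "(\<lambda>n. \<integral>x. (cmod (f x - s n x))\<^sup>2 \<partial>M) \<longlonglongrightarrow> (\<integral>x. 0 \<partial>M)"
  proof (rule integral_dominated_convergence[OF _ _ w(1)])
    have "(\<lambda>n. (cmod (f x - s n x))\<^sup>2) \<longlonglongrightarrow> (cmod (f x - f x))\<^sup>2" for x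
      by (intro tendsto_intros lim)
    then show "AE x in M. (\<lambda>n. (cmod (f x - s n x))\<^sup>2) \<longlonglongrightarrow> 0" by simp
    show "AE x in M. norm ((cmod (f x - s n x))\<^sup>2) \<le> w x" for n
      using w(2) by simp
  qed simp_all
  then have "\<forall>\<^sub>F n in sequentially. (\<integral>x. (cmod (f x - s n x))\<^sup>2 \<partial>M) < \<epsilon>"
    using \<open>\<epsilon> > 0\<close> by (intro order_tendstoD) auto
  then obtain n where "(\<integral>x. (cmod (f x - s n x))\<^sup>2 \<partial>M) < \<epsilon>"
    by (auto simp: eventually_sequentially)
  with s show "\<exists>g\<in>cl. (\<integral>x. (cmod (f x - g x))\<^sup>2 \<partial>M) < \<epsilon>" by blast
qed

end

section \<open>Approximation by trigonometric sums\<close>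

inductive_set trig_sums :: "(real \<Rightarrow> complex) set" where
  trig_exp: "(\<lambda>x. cis (t * x)) \<in> trig_sums"
| trig_add: "f \<in> trig_sums \<Longrightarrow> g \<in> trig_sums \<Longrightarrow> (\<lambda>x. f x + g x) \<in> trig_sums"
| trig_scale: "f \<in> trig_sums \<Longrightarrow> (\<lambda>x. c * f x) \<in> trig_sums"

lemma trig_mult:
  assumes "f \<in> trig_sums" "g \<in> trig_sums"
  shows "(\<lambda>x. f x * g x) \<in> trig_sums"
  using assms(1)
proof induction
  case (trig_exp t)
  show ?case
    using assms(2)
  proof induction
    case (trig_exp s)
    show ?case
      using trig_sums.trig_exp[of "t + s"] by (simp add: cis_mult algebra_simps)
  next
    case (trig_add f g)
    then show ?case using trig_sums.trig_add by (simp add: algebra_simps)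
  next
    case (trig_scale f c)
    then show ?case using trig_sums.trig_scale[of _ c] by (simp add: mult_ac)
  qed
next
  case (trig_add f h)
  then show ?case using trig_sums.trig_add by (simp add: algebra_simps)
next
  case (trig_scale f c)
  then show ?case using trig_sums.trig_scale[of _ c] by (simp add: mult_ac)
qed

lemma trig_continuous: "f \<in> trig_sums \<Longrightarrow> continuous_on S f"
  by (induction rule: trig_sums.induct) (auto intro!: continuous_intros)

text \<open>Stone-Weierstrass for the algebra of real functions whose complex versions are
  trigonometric sums. It contains \<open>cos\<close>, which is injective on the unit interval and
  hence separates points.\<close>

lemma trig_sums_uniformly_dense:
  fixes f :: "real \<Rightarrow> real"
  assumes "continuous_on {0..1} f" "\<epsilon> > 0"
  obtains g where "g \<in> trig_sums" "\<And>x. x \<in> {0..1} \<Longrightarrow> cmod (of_real (f x) - g x) < \<epsilon>"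
proof -
  define R where "R = {g :: real \<Rightarrow> real. (\<lambda>x. of_real (g x)) \<in> trig_sums}"
  interpret function_ring_on R "{0..1 :: real}"
  proof
    show "compact {0..1 :: real}" by simp
    fix g :: "real \<Rightarrow> real" assume g: "g \<in> R"
    then have "continuous_on {0..1} (\<lambda>x. Re (of_real (g x)))"
      by (intro continuous_on_Re trig_continuous) (simp add: R_def)
    then show "continuous_on {0..1} g" by simp
    fix h assume h: "h \<in> R"
    show "(\<lambda>x. g x + h x) \<in> R" using trig_add g h by (simp add: R_def)
    show "(\<lambda>x. g x * h x) \<in> R" using trig_mult g h by (simp add: R_def)
  next
    fix c :: real
    show "(\<lambda>_. c) \<in> R"
      using trig_scale[OF trig_exp[of 0], of "of_real c"] by (simp add: R_def)
  next
    fix x y :: real assume xy: "x \<in> {0..1}" "y \<in> {0..1}" "x \<noteq> y"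
    have "(\<lambda>x. 1 / 2 * (cis (1 * x) + cis (- 1 * x))) \<in> trig_sums"
      by (intro trig_scale trig_add trig_exp)
    moreover have "1 / 2 * (cis (1 * x) + cis (- 1 * x)) = of_real (cos x)" for x
      by (simp add: complex_eq_iff)
    ultimately have "cos \<in> R" by (simp add: R_def)
    moreover have "cos x \<noteq> cos y"
      using xy pi_gt3 cos_inj_pi[of x y] by auto
    ultimately show "\<exists>f\<in>R. f x \<noteq> f y" by blast
  qed
  obtain g where g: "g \<in> R" "\<forall>x\<in>{0..1}. \<bar>f x - g x\<bar> < \<epsilon>"
    using Stone_Weierstrass_basic[OF assms] by blast
  show thesis
  proof (rule that)
    show "(\<lambda>x. of_real (g x)) \<in> trig_sums" using g by (simp add: R_def)
    show "cmod (of_real (f x) - of_real (g x)) < \<epsilon>" if "x \<in> {0..1}" for x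
      using g that by (simp del: of_real_diff add: of_real_diff[symmetric])
  qed
qed

section \<open>From exponentials to all square-integrable functions\<close>

context L2_subspace
begin

context
  assumes supp: "AE x in M. x \<in> {0..1}"
    and exps: "\<And>t. (\<lambda>x. cis (t * x)) \<in> cl"
begin

lemma trig_sums_cl: "f \<in> trig_sums \<Longrightarrow> f \<in> cl"
  by (induction rule: trig_sums.induct) (auto intro: exps cl_add cl_scale)

lemma continuous_cl:
  fixes f :: "real \<Rightarrow> real"
  assumes f: "continuous_on UNIV f" "\<And>x. \<bar>f x\<bar> \<le> C"
  shows "(\<lambda>x. of_real (f x)) \<in> cl"
proof (rule cl_limit)
  have "f \<in> borel_measurable borel" using f by (intro borel_measurable_continuous_onI)
  then have meas: "f \<in> borel_measurable M" by (simp add: measurable_def)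
  then show L2: "(\<lambda>x. complex_of_real (f x)) \<in> L2_functions M"
    using f by (intro bounded_in_L2_functions[of _ C]) auto
  fix \<epsilon> :: real assume "\<epsilon> > 0"
  then have "sqrt (\<epsilon> / 2) > 0" by simp
  moreover have "continuous_on {0..1} f" using f continuous_on_subset by blast
  ultimately obtain g where g: "g \<in> trig_sums"
    "\<And>x. x \<in> {0..1} \<Longrightarrow> cmod (of_real (f x) - g x) < sqrt (\<epsilon> / 2)"
    using trig_sums_uniformly_dense by blast
  have gcl: "g \<in> cl" by (rule trig_sums_cl[OF g(1)])
  have "(\<integral>x. (cmod (of_real (f x) - g x))\<^sup>2 \<partial>M) \<le> (\<integral>x. \<epsilon> / 2 \<partial>M)"
  proof (rule integral_mono_AE)
    show "integrable M (\<lambda>x. (cmod (of_real (f x) - g x))\<^sup>2)"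
      using L2_functions_diff[OF L2 cl_L2[OF gcl]] by (simp add: L2_functions_def)
    show "AE x in M. (cmod (of_real (f x) - g x))\<^sup>2 \<le> \<epsilon> / 2"
      using supp
    proof eventually_elim
      case (elim x)
      have "(cmod (of_real (f x) - g x))\<^sup>2 \<le> (sqrt (\<epsilon> / 2))\<^sup>2"
        using g(2)[OF elim] by (intro power_mono) auto
      with \<open>\<epsilon> > 0\<close> show ?case by simp
    qed
  qed simp
  also have "\<dots> < \<epsilon>"
    using \<open>\<epsilon> > 0\<close> by (simp add: prob_space del: space_eq_univ)
  finally show "\<exists>g\<in>cl. (\<integral>x. (cmod (of_real (f x) - g x))\<^sup>2 \<partial>M) < \<epsilon>"
    using gcl by blast
qed

lemma indicator_atMost_cl: "indicator {..a} \<in> cl"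
proof (rule cl_dominated_limit)
  \<comment> \<open>For positive \<open>n\<close>, a ramp that falls linearly from 1 at
    \<open>a\<close> to 0 at \<open>a + 1 / n\<close>.\<close>
  define r where "r n x = max 0 (min 1 (1 - real n * (x - a)))" for n x
  show "indicator {..a} \<in> L2_functions M"
    by (intro bounded_in_L2_functions[of _ 1]) (auto split: split_indicator)
  show "(\<lambda>x. complex_of_real (r n x)) \<in> cl" for n
    by (rule continuous_cl[of _ 1]) (auto simp: r_def intro!: continuous_intros)
  show "(\<lambda>n. complex_of_real (r n x)) \<longlonglongrightarrow> indicator {..a} x" for x
  proof (cases "x \<le> a")
    case True
    then have "real n * (x - a) \<le> 0" for n
      by (intro mult_nonneg_nonpos) auto
    then have "r n x = 1" for n by (simp add: r_def)
    with True show ?thesis by simp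
  next
    case False
    then obtain m where m: "1 / (x - a) < real m" using reals_Archimedean2 by blast
    have "r n x = 0" if "n \<ge> m" for n
    proof -
      have "1 / (x - a) \<le> real n" using m that by simp
      with False have "1 \<le> real n * (x - a)" by (simp add: field_simps)
      then show ?thesis by (simp add: r_def)
    qed
    then have "\<forall>\<^sub>F n in sequentially. complex_of_real (r n x) = 0"
      by (auto simp: eventually_sequentially)
    with False show ?thesis by (auto intro: tendsto_eventually)
  qed
  show "(cmod (indicator {..a} x - of_real (r n x)))\<^sup>2 \<le> 1" for n x
  proof -
    have "indicator {..a} x - complex_of_real (r n x) = of_real (indicator {..a} x - r n x)"
      by (simp split: split_indicator)
    then show ?thesis
      by (simp only: norm_of_real) (auto simp: r_def abs_square_le_1 split: split_indicator)
  qed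
qed simp

text \<open>Dynkin's argument: the closed half-lines form an intersection-stable generator, and the
  sets with indicator in \<open>cl\<close> are closed under complements and countable disjoint
  unions.\<close>

lemma indicator_cl:
  assumes "A \<in> sets borel"
  shows "indicator A \<in> cl"
proof -
  have bnd: "indicator A \<in> L2_functions M" if "A \<in> sets borel" for A
    using that by (intro bounded_in_L2_functions[of _ 1]) (auto split: split_indicator)
  have "Int_stable (range (\<lambda>a :: real. {..a}))" by (auto simp: Int_stable_def)
  moreover have "range (\<lambda>a :: real. {..a}) \<subseteq> Pow UNIV" by simp
  moreover have sets: "sigma_sets UNIV (range (\<lambda>a :: real. {..a})) = sets borel"
    by (simp add: borel_eq_atMost)
  then have "A \<in> sigma_sets UNIV (range (\<lambda>a :: real. {..a}))" using assms by simp
  ultimately show ?thesis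
  proof (induction rule: sigma_sets_induct_disjoint)
    case (basic A)
    then show ?case using indicator_atMost_cl by auto
  next
    case empty
    show ?case using cl_scale[OF indicator_atMost_cl[of 0], of 0] by (simp add: indicator_def[abs_def])
  next
    case (compl A)
    \<comment> \<open>The exponential of frequency 0 supplies the constant 1.\<close>
    have "(\<lambda>x. cis (0 * x) + (- 1) * indicator A x) \<in> cl"
      by (intro cl_add exps cl_scale compl)
    moreover have "(\<lambda>x. cis (0 * x) + (- 1) * indicator A x) = (indicator (UNIV - A) :: real \<Rightarrow> complex)"
      by (auto split: split_indicator)
    ultimately show ?case by simp
  next
    case (union A)
    have zero: "(\<lambda>x. 0) \<in> cl" using cl_scale[OF exps[of 0], of 0] by simp
    show ?case
    proof (rule cl_dominated_limit)
      show "indicator (\<Union>i. A i) \<in> L2_functions M"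
        using union.hyps(2) unfolding sets by (intro bnd sets.countable_UN) auto
      show "(\<lambda>x. \<Sum>i<n. indicator (A i) x) \<in> cl" for n
        by (induction n) (auto intro: zero cl_add union.IH)
      have eq: "(\<Sum>i<n. indicator (A i) x) = (indicator (\<Union>i<n. A i) x :: complex)" for n x
        using union.hyps(1)
        by (intro indicator_UN_disjoint[symmetric]) (auto simp: disjoint_family_on_def)
      show "(\<lambda>n. \<Sum>i<n. indicator (A i) x) \<longlonglongrightarrow> (indicator (\<Union>i. A i) x :: complex)" for x
        unfolding eq by (rule LIMSEQ_indicator_UN)
      show "(cmod (indicator (\<Union>i. A i) x - (\<Sum>i<n. indicator (A i) x)))\<^sup>2 \<le> 1" for n x
        unfolding eq by (auto split: split_indicator)
    qed simp
  qed
qed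

lemma simple_cl:
  assumes "simple_function M f"
  shows "f \<in> cl"
proof -
  have sum: "(\<lambda>x. \<Sum>y\<in>Y. y * indicator (f -` {y} \<inter> space M) x) \<in> cl" if "finite Y" for Y
    using that
  proof (induction Y)
    case empty
    show ?case using cl_scale[OF exps[of 0], of 0] by simp
  next
    case (insert y Y)
    have "f -` {y} \<inter> space M \<in> sets borel"
      using assms by (auto dest: simple_functionD)
    then have "(\<lambda>x. y * indicator (f -` {y} \<inter> space M) x) \<in> cl"
      by (intro cl_scale indicator_cl)
    from cl_add[OF this insert.IH] show ?case by (simp only: sum.insert[OF insert.hyps])
  qed
  have "f = (\<lambda>x. \<Sum>y\<in>f ` space M. y * indicator (f -` {y} \<inter> space M) x)"
  proof
    fix x
    have "f x = (\<Sum>y\<in>f ` space M. indicator (f -` {y} \<inter> space M) x *\<^sub>R y)"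
      using assms by (intro simple_function_indicator_representation_banach) auto
    also have "\<dots> = (\<Sum>y\<in>f ` space M. y * indicator (f -` {y} \<inter> space M) x)"
      by (intro sum.cong refl) (simp split: split_indicator)
    finally show "f x = (\<Sum>y\<in>f ` space M. y * indicator (f -` {y} \<inter> space M) x)" .
  qed
  also have "\<dots> \<in> cl" using assms by (intro sum simple_functionD)
  finally show ?thesis .
qed

theorem L2_functions_subset_cl:
  assumes f: "f \<in> L2_functions M"
  shows "f \<in> cl"
proof -
  have "f \<in> borel_measurable M" using f by (simp add: L2_functions_def)
  from borel_measurable_implies_sequence_metric[OF this, of 0]
  obtain s where s: "\<And>i. simple_function M (s i)"
    and lim: "\<And>x. x \<in> space M \<Longrightarrow> (\<lambda>i. s i x) \<longlonglongrightarrow> f x"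
    and bound: "\<And>i x. x \<in> space M \<Longrightarrow> dist (s i x) 0 \<le> 2 * dist (f x) 0"
    by blast
  show ?thesis
  proof (rule cl_dominated_limit[OF f])
    show "s i \<in> cl" for i by (rule simple_cl[OF s])
    show "(\<lambda>i. s i x) \<longlonglongrightarrow> f x" for x using lim by simp
    \<comment> \<open>The simple functions satisfy \<open>cmod (s i x) \<le> 2 * cmod (f x)\<close>,
      so the error is at most \<open>3 * cmod (f x)\<close>.\<close>
    show "integrable M (\<lambda>x. 9 * (cmod (f x))\<^sup>2)"
      using f by (simp add: L2_functions_def)
    fix i x
    have "cmod (f x - s i x) \<le> cmod (f x) + cmod (s i x)" by (rule norm_triangle_ineq4)
    also have "\<dots> \<le> 3 * cmod (f x)" using bound[of x i] by simp
    finally have "(cmod (f x - s i x))\<^sup>2 \<le> (3 * cmod (f x))\<^sup>2" by (intro power_mono) auto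
    then show "(cmod (f x - s i x))\<^sup>2 \<le> 9 * (cmod (f x))\<^sup>2"
      by (simp add: power_mult_distrib)
  qed
qed

end

end


section \<open>The spectrum of the infinite convolution\<close>

lemma liminf_card_bounded_frequently:
  assumes "liminf (\<lambda>n. enat (card (B n))) < \<infinity>"
  obtains m where "m \<ge> 1" "\<And>n0. \<exists>n\<ge>n0. card (B (Suc n)) \<le> m"
proof -
  obtain k where k: "liminf (\<lambda>n. enat (card (B n))) = enat k"
    using assms by auto
  then have "\<not> enat (Suc k) \<le> liminf (\<lambda>n. enat (card (B n)))" by simp
  then obtain y where y: "y < enat (Suc k)" "\<not> (\<forall>\<^sub>F n in sequentially. y < enat (card (B n)))"
    unfolding le_Liminf_iff by blast
  have "\<exists>n\<ge>n0. card (B (Suc n)) \<le> Suc k" for n0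
  proof -
    \<comment> \<open>Starting at \<open>Suc n0\<close> makes \<open>n - 1\<close> a witness that is
      at least \<open>n0\<close> and has successor \<open>n\<close>.\<close>
    obtain n where n: "n \<ge> Suc n0" "\<not> y < enat (card (B n))"
      using y(2) by (auto simp: eventually_sequentially)
    then have "enat (card (B n)) \<le> y" by (simp add: not_less)
    then have "enat (card (B n)) < enat (Suc k)" using y(1) by (rule le_less_trans)
    with n show ?thesis by (intro exI[of _ "n - 1"]) auto
  qed
  then show thesis by (rule that[rotated]) simp
qed

context digit_sequence
begin

lemma has_bochner_integral_exponentials:
  "has_bochner_integral (cantor_moran_measure N B)
     (\<lambda>x. cis (2 * pi * s * x) * cnj (cis (2 * pi * t * x))) (tail_char 0 (s - t))"
proof -
  interpret real_distribution "cantor_moran_measure N B" by (rule real_distribution_cantor_moran)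
  have "integrable (cantor_moran_measure N B) (\<lambda>x. iexp (2 * pi * (s - t) * x))"
    by (intro integrable_iexp) auto
  then have "has_bochner_integral (cantor_moran_measure N B) (\<lambda>x. iexp (2 * pi * (s - t) * x)) (tail_char 0 (s - t))"
    by (simp add: has_bochner_integral_iff tail_char_def char_def)
  moreover have "cis (2 * pi * s * x) * cnj (cis (2 * pi * t * x)) = iexp (2 * pi * (s - t) * x)" for x
    unfolding cis_conv_exp[symmetric] by (simp add: cis_cnj cis_mult algebra_simps)
  ultimately show ?thesis by simp
qed

text \<open>The transform of a positive measure is Hermitian. This reconciles the Parseval sums over
  \<open>\<xi> + t\<close> with the coefficients \<open>tail_char 0 (s - t)\<close>.\<close>

lemma norm_tail_char_minus: "cmod (tail_char 0 (- \<xi>)) = cmod (tail_char 0 \<xi>)"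
proof -
  have "tail_char 0 (- \<xi>) = cnj (tail_char 0 \<xi>)"
    using has_bochner_integral_cnj[OF has_bochner_integral_exponentials[of \<xi> 0]]
      has_bochner_integral_exponentials[of 0 \<xi>]
    by (simp add: has_bochner_integral_eq)
  then show ?thesis by simp
qed

text \<open>The coefficients are the inner products with an orthonormal family, so this is the
  equality behind Bessel's inequality. In the expanded square both mixed terms and the double sum
  equal the same sum of squares, with signs minus, minus, plus.\<close>

lemma exponential_approximation_error:
  fixes F :: "real set"
  assumes "finite F"
    and orth: "\<And>s t. s \<in> F \<Longrightarrow> t \<in> F \<Longrightarrow> s \<noteq> t \<Longrightarrow> tail_char 0 (s - t) = 0"
  shows "(\<integral>x. (cmod (cis (2 * pi * s * x) - (\<Sum>t\<in>F. tail_char 0 (s - t) * cis (2 * pi * t * x))))\<^sup>2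
      \<partial>cantor_moran_measure N B) = 1 - (\<Sum>t\<in>F. (cmod (tail_char 0 (s - t)))\<^sup>2)"
proof -
  let ?M = "cantor_moran_measure N B"
  define e where "e t x = cis (2 * pi * t * x)" for t x
  define c where "c t = tail_char 0 (s - t)" for t
  have hb: "has_bochner_integral ?M (\<lambda>x. e t x * cnj (e t' x)) (tail_char 0 (t - t'))" for t t'
    unfolding e_def by (rule has_bochner_integral_exponentials)
  have conj: "tail_char 0 (t - s) = cnj (c t)" for t
    using has_bochner_integral_cnj[OF hb[of s t]] hb[of t s]
    by (auto simp: c_def mult.commute intro: has_bochner_integral_eq)
  have "has_bochner_integral ?M
      (\<lambda>x. e s x * cnj (e s x) - (\<Sum>t\<in>F. cnj (c t) * (e s x * cnj (e t x)))
         - (\<Sum>t\<in>F. c t * (e t x * cnj (e s x)))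
         + (\<Sum>t\<in>F. \<Sum>t'\<in>F. c t * cnj (c t') * (e t x * cnj (e t' x))))
      (tail_char 0 (s - s) - (\<Sum>t\<in>F. cnj (c t) * tail_char 0 (s - t))
         - (\<Sum>t\<in>F. c t * tail_char 0 (t - s))
         + (\<Sum>t\<in>F. \<Sum>t'\<in>F. c t * cnj (c t') * tail_char 0 (t - t')))"
    by (intro has_bochner_integral_add has_bochner_integral_diff has_bochner_integral_sum
        has_bochner_integral_mult_right hb)
  also have "(\<lambda>x. e s x * cnj (e s x) - (\<Sum>t\<in>F. cnj (c t) * (e s x * cnj (e t x)))
         - (\<Sum>t\<in>F. c t * (e t x * cnj (e s x)))
         + (\<Sum>t\<in>F. \<Sum>t'\<in>F. c t * cnj (c t') * (e t x * cnj (e t' x))))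
      = (\<lambda>x. complex_of_real ((cmod (e s x - (\<Sum>t\<in>F. c t * e t x)))\<^sup>2))"
  proof
    fix x
    define S where "S = (\<Sum>t\<in>F. c t * e t x)"
    have "(\<Sum>t\<in>F. cnj (c t) * (e s x * cnj (e t x))) = e s x * cnj S"
      by (simp add: S_def sum_distrib_left mult_ac)
    moreover have "(\<Sum>t\<in>F. c t * (e t x * cnj (e s x))) = S * cnj (e s x)"
      by (simp add: S_def sum_distrib_right mult.assoc)
    moreover have "(\<Sum>t\<in>F. \<Sum>t'\<in>F. c t * cnj (c t') * (e t x * cnj (e t' x))) = S * cnj S"
      by (simp add: S_def sum_product mult_ac)
    moreover have "complex_of_real ((cmod (e s x - S))\<^sup>2) = (e s x - S) * cnj (e s x - S)"
      by (rule complex_norm_square)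
    ultimately show "e s x * cnj (e s x) - (\<Sum>t\<in>F. cnj (c t) * (e s x * cnj (e t x)))
         - (\<Sum>t\<in>F. c t * (e t x * cnj (e s x)))
         + (\<Sum>t\<in>F. \<Sum>t'\<in>F. c t * cnj (c t') * (e t x * cnj (e t' x)))
      = complex_of_real ((cmod (e s x - (\<Sum>t\<in>F. c t * e t x)))\<^sup>2)"
      by (simp add: S_def[symmetric] algebra_simps del: of_real_power)
  qed
  also have "(\<Sum>t\<in>F. \<Sum>t'\<in>F. c t * cnj (c t') * tail_char 0 (t - t')) = (\<Sum>t\<in>F. c t * cnj (c t))"
  proof (intro sum.cong refl)
    fix t assume t: "t \<in> F"
    \<comment> \<open>Orthogonality leaves only the diagonal of the double sum.\<close>
    have "(\<Sum>t'\<in>F. c t * cnj (c t') * tail_char 0 (t - t')) = (\<Sum>t'\<in>F. if t' = t then c t * cnj (c t) else 0)"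
      using orth t by (intro sum.cong refl) (auto simp: tail_char_0_at_0)
    then show "(\<Sum>t'\<in>F. c t * cnj (c t') * tail_char 0 (t - t')) = c t * cnj (c t)"
      using assms(1) t by simp
  qed
  also have "(\<Sum>t\<in>F. c t * tail_char 0 (t - s)) = (\<Sum>t\<in>F. c t * cnj (c t))"
    by (simp add: conj)
  also have "(\<Sum>t\<in>F. cnj (c t) * tail_char 0 (s - t)) = (\<Sum>t\<in>F. c t * cnj (c t))"
    by (simp add: c_def mult.commute)
  also have "(\<Sum>t\<in>F. c t * cnj (c t)) = complex_of_real (\<Sum>t\<in>F. (cmod (c t))\<^sup>2)"
    by (simp add: complex_norm_square del: of_real_power)
  finally have "has_bochner_integral ?M (\<lambda>x. complex_of_real ((cmod (e s x - (\<Sum>t\<in>F. c t * e t x)))\<^sup>2))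
      (complex_of_real (1 - (\<Sum>t\<in>F. (cmod (c t))\<^sup>2)))"
    by (simp add: tail_char_0_at_0)
  then have "complex_of_real (\<integral>x. (cmod (e s x - (\<Sum>t\<in>F. c t * e t x)))\<^sup>2 \<partial>?M)
      = complex_of_real (1 - (\<Sum>t\<in>F. (cmod (c t))\<^sup>2))"
    by (simp only: has_bochner_integral_integral_eq integral_complex_of_real[symmetric])
  then show ?thesis
    unfolding of_real_eq_iff e_def c_def .
qed

text \<open>The criterion of Jorgensen and Pedersen.\<close>

lemma is_spectrum_criterion:
  assumes \<Lambda>: "countable \<Lambda>"
    and orth: "\<And>s t. s \<in> \<Lambda> \<Longrightarrow> t \<in> \<Lambda> \<Longrightarrow> s \<noteq> t \<Longrightarrow> tail_char 0 (s - t) = 0"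
    and parseval: "\<And>\<xi> \<epsilon>. \<epsilon> > 0 \<Longrightarrow>
      \<exists>F. finite F \<and> F \<subseteq> \<Lambda> \<and> 1 - \<epsilon> < (\<Sum>t\<in>F. (cmod (tail_char 0 (\<xi> + t)))\<^sup>2)"
  shows "is_spectrum (cantor_moran_measure N B) \<Lambda>"
proof -
  let ?M = "cantor_moran_measure N B"
  interpret M: real_distribution ?M by (rule real_distribution_cantor_moran)
  define e where "e t x = cis (2 * pi * t * x)" for t x :: real
  have e_eq: "(\<lambda>l x. exp (2 * of_real pi * \<i> * of_real l * of_real x)) = e"
    by (simp add: e_def cis_conv_exp fun_eq_iff mult_ac)
  have e_L2: "e t \<in> L2_functions ?M" for t
  proof (rule M.bounded_in_L2_functions)
    have "e t \<in> borel_measurable borel"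
      unfolding e_def by (intro borel_measurable_continuous_onI continuous_intros)
    then show "e t \<in> borel_measurable ?M" by (simp add: measurable_def)
    show "cmod (e t x) \<le> 1" for x by (simp add: e_def)
  qed
  define V where "V = {f. \<exists>F c. finite F \<and> F \<subseteq> \<Lambda> \<and> f = (\<lambda>x. \<Sum>t\<in>F. c t * e t x)}"
  have V_iff: "f \<in> V \<longleftrightarrow> (\<exists>F c. finite F \<and> F \<subseteq> \<Lambda> \<and> f = (\<lambda>x. \<Sum>t\<in>F. c t * e t x))" for f
    by (simp add: V_def)
  interpret L2_subspace ?M V
  proof
    have "(\<lambda>x. \<Sum>t\<in>F. c t * e t x) \<in> L2_functions ?M" if "finite F" for F c
      using that
    proof induction
      case empty
      show ?case by (simp add: L2_functions_def)
    next
      case (insert t F)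
      then show ?case by (simp add: L2_functions_add L2_functions_scale e_L2)
    qed
    then show "V \<subseteq> L2_functions ?M" by (auto simp: V_def)
  next
    fix f g assume "f \<in> V" "g \<in> V"
    then obtain F c G d where F: "finite F" "F \<subseteq> \<Lambda>" "f = (\<lambda>x. \<Sum>t\<in>F. c t * e t x)"
      and G: "finite G" "G \<subseteq> \<Lambda>" "g = (\<lambda>x. \<Sum>t\<in>G. d t * e t x)"
      unfolding V_iff by blast
    define h where "h t = (if t \<in> F then c t else 0) + (if t \<in> G then d t else 0)" for t
    have "f x + g x = (\<Sum>t\<in>F \<union> G. h t * e t x)" for x
    proof -
      have "f x = (\<Sum>t\<in>F \<union> G. (if t \<in> F then c t else 0) * e t x)"
        unfolding F(3) using F(1) G(1) by (intro sum.mono_neutral_cong_left) auto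
      moreover have "g x = (\<Sum>t\<in>F \<union> G. (if t \<in> G then d t else 0) * e t x)"
        unfolding G(3) using F(1) G(1) by (intro sum.mono_neutral_cong_left) auto
      ultimately show ?thesis
        by (simp add: h_def distrib_right sum.distrib)
    qed
    then show "(\<lambda>x. f x + g x) \<in> V"
      unfolding V_iff using F G by (intro exI[of _ "F \<union> G"] exI[of _ h]) auto
  next
    fix f c assume "f \<in> V"
    then obtain F d where "finite F" "F \<subseteq> \<Lambda>" "f = (\<lambda>x. \<Sum>t\<in>F. d t * e t x)"
      unfolding V_iff by blast
    then show "(\<lambda>x. c * f x) \<in> V"
      unfolding V_iff
      by (intro exI[of _ F] exI[of _ "\<lambda>t. c * d t"]) (auto simp: sum_distrib_left mult.assoc)
  qed
  have e_cl: "(\<lambda>x. cis (t * x)) \<in> cl" for t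
  proof -
    define s where "s = t / (2 * pi)"
    have t: "(\<lambda>x. cis (t * x)) = e s" by (simp add: e_def[abs_def] s_def)
    \<comment> \<open>The Parseval condition at \<open>\<xi> = - s\<close> makes the deficit from 1
      less than \<open>\<epsilon>\<close>, and this deficit is the squared error of the
      approximation in \<open>V\<close>. The frequency \<open>s\<close> is an arbitrary real
      number.\<close>
    have "\<exists>g\<in>V. (\<integral>x. (cmod (e s x - g x))\<^sup>2 \<partial>?M) < \<epsilon>" if \<epsilon>: "\<epsilon> > 0" for \<epsilon>
    proof -
      obtain F where F: "finite F" "F \<subseteq> \<Lambda>"
        and sum: "1 - \<epsilon> < (\<Sum>t\<in>F. (cmod (tail_char 0 (- s + t)))\<^sup>2)"
        using parseval[OF \<epsilon>] by blast
      have "(\<integral>x. (cmod (e s x - (\<Sum>t\<in>F. tail_char 0 (s - t) * e t x)))\<^sup>2 \<partial>?M)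
          = 1 - (\<Sum>t\<in>F. (cmod (tail_char 0 (s - t)))\<^sup>2)"
        unfolding e_def using F orth by (intro exponential_approximation_error) auto
      also have "\<dots> = 1 - (\<Sum>t\<in>F. (cmod (tail_char 0 (- s + t)))\<^sup>2)"
        using norm_tail_char_minus[of "s - t" for t] by simp
      finally have "(\<integral>x. (cmod (e s x - (\<Sum>t\<in>F. tail_char 0 (s - t) * e t x)))\<^sup>2 \<partial>?M) < \<epsilon>"
        using sum by simp
      moreover have "(\<lambda>x. \<Sum>t\<in>F. tail_char 0 (s - t) * e t x) \<in> V"
        unfolding V_iff using F by (intro exI[of _ F] exI[of _ "\<lambda>t. tail_char 0 (s - t)"]) simp
      ultimately show ?thesis by (rule bexI)
    qed
    then show ?thesis unfolding t cl_def using e_L2 by simp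
  qed
  have "L2_orthonormal_basis ?M \<Lambda> e"
    unfolding L2_orthonormal_basis_def
  proof (intro conjI ballI allI impI e_L2)
    fix s t assume "s \<in> \<Lambda>" "t \<in> \<Lambda>"
    then show "L2_inner ?M (e s) (e t) = (if s = t then 1 else 0)"
      using has_bochner_integral_integral_eq[OF has_bochner_integral_exponentials[of s t]] orth[of s t]
      by (auto simp: L2_inner_def e_def tail_char_0_at_0)
  next
    fix f \<epsilon> assume "f \<in> L2_functions ?M" "\<epsilon> > (0::real)"
    \<comment> \<open>The closure is defined by squared distances and a basis by distances, hence
      the error \<open>\<epsilon>\<^sup>2\<close>.\<close>
    then have "f \<in> cl" "\<epsilon>\<^sup>2 > 0"
      using L2_functions_subset_cl[OF AE_cantor_moran e_cl] by auto
    then obtain g where "g \<in> V" and g: "(\<integral>x. (cmod (f x - g x))\<^sup>2 \<partial>?M) < \<epsilon>\<^sup>2"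
      unfolding cl_def by blast
    then obtain F c where F: "finite F" "F \<subseteq> \<Lambda>" and g_eq: "g = (\<lambda>x. \<Sum>t\<in>F. c t * e t x)"
      unfolding V_iff by auto
    have "sqrt (\<integral>x. (cmod (f x - (\<Sum>t\<in>F. c t * e t x)))\<^sup>2 \<partial>?M) < \<epsilon>"
      using g \<open>\<epsilon> > 0\<close> unfolding g_eq by (simp add: real_less_lsqrt)
    with F show "\<exists>F c. finite F \<and> F \<subseteq> \<Lambda> \<and> sqrt (\<integral>x. (cmod (f x - (\<Sum>t\<in>F. c t * e t x)))\<^sup>2 \<partial>?M) < \<epsilon>"
      by (intro exI[of _ F] exI[of _ c]) simp
  qed
  with \<Lambda> show ?thesis by (simp add: is_spectrum_def e_eq)
qed

end

context hadamard_sequence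
begin

lemma integer_spectrum_exists:
  assumes "m \<ge> 1" "\<And>n0. \<exists>n\<ge>n0. card (B (Suc n)) \<le> m"
  shows "\<exists>\<Lambda>\<subseteq>\<int>. is_spectrum (cantor_moran_measure N B) \<Lambda>"
proof -
  obtain \<epsilon> :: real and n :: "nat \<Rightarrow> nat" and \<Gamma> :: "nat \<Rightarrow> int set"
    where \<epsilon>: "\<epsilon> > 0" and n: "strict_mono n" and mono: "mono \<Gamma>"
    and level: "\<And>j. spectral_level (n j) (\<Gamma> j)"
    and lower: "\<And>j \<gamma>. \<gamma> \<in> \<Gamma> j \<Longrightarrow> \<epsilon> \<le> cmod (tail_char (n j) (of_int \<gamma> / base_prod N (n j)))"
    using spectral_levels_exist[OF assms] by blast
  define \<Lambda> where "\<Lambda> = real_of_int ` (\<Union>j. \<Gamma> j)"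
  have "is_spectrum (cantor_moran_measure N B) \<Lambda>"
  proof (rule is_spectrum_criterion)
    show "countable \<Lambda>" by (simp add: \<Lambda>_def)
  next
    fix s t assume "s \<in> \<Lambda>" "t \<in> \<Lambda>" "s \<noteq> t"
    then obtain \<gamma> \<gamma>' i j where st: "s = of_int \<gamma>" "t = of_int \<gamma>'" "\<gamma> \<in> \<Gamma> i" "\<gamma>' \<in> \<Gamma> j" "\<gamma> \<noteq> \<gamma>'"
      by (auto simp: \<Lambda>_def)
    \<comment> \<open>By nesting, both frequencies lie in one finite spectrum. The product of the
      factors at that level vanishes at their difference, and it divides the full transform.\<close>
    then have "\<gamma> \<in> \<Gamma> (max i j)" "\<gamma>' \<in> \<Gamma> (max i j)"
      using mono monoD[of \<Gamma> i "max i j"] monoD[of \<Gamma> j "max i j"] by auto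
    with st have "mask_poly_prod N B (n (max i j)) (of_int (\<gamma> - \<gamma>')) = 0"
      by (intro spectral_level_orthogonal[OF level])
    then show "tail_char 0 (s - t) = 0"
      using st by (subst tail_char_0_eq[of _ "n (max i j)"]) simp
  next
    fix \<xi> \<delta> :: real assume "\<delta> > 0"
    then have "\<forall>\<^sub>F j in sequentially. 1 - \<delta> < (\<Sum>\<gamma>\<in>\<Gamma> j. (cmod (tail_char 0 (\<xi> + of_int \<gamma>)))\<^sup>2)"
      using tail_char_parseval[OF \<epsilon> n mono level lower, of \<xi>] by (intro order_tendstoD) auto
    then obtain j where j: "1 - \<delta> < (\<Sum>\<gamma>\<in>\<Gamma> j. (cmod (tail_char 0 (\<xi> + of_int \<gamma>)))\<^sup>2)"
      by (auto simp: eventually_sequentially)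
    have "finite (\<Gamma> j)" using level[of j] by (simp add: spectral_level_def)
    with j show "\<exists>F. finite F \<and> F \<subseteq> \<Lambda> \<and> 1 - \<delta> < (\<Sum>t\<in>F. (cmod (tail_char 0 (\<xi> + t)))\<^sup>2)"
      by (intro exI[of _ "real_of_int ` \<Gamma> j"]) (auto simp: \<Lambda>_def sum.reindex inj_on_def)
  qed
  moreover have "\<Lambda> \<subseteq> \<int>" by (auto simp: \<Lambda>_def)
  ultimately show ?thesis by blast
qed

end

theorem theorem1p3:
  fixes N :: "nat \<Rightarrow> nat" and B L :: "nat \<Rightarrow> int set"
  assumes "\<And>n. n \<ge> 1 \<Longrightarrow> hadamard_triple (N n) (B n) (L n)"
    and "\<And>n. n \<ge> 1 \<Longrightarrow> B n \<subseteq> {0..int (N n) - 1}"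
    and "liminf (\<lambda>n. enat (card (B n))) < \<infinity>"
  shows "spectral_measure (cantor_moran_measure N B) \<and>
         (\<exists>\<Lambda>\<subseteq>\<int>. is_spectrum (cantor_moran_measure N B) \<Lambda>)"
proof -
  interpret hadamard_sequence N B L
    using assms by unfold_locales auto
  obtain m where "m \<ge> 1" "\<And>n0. \<exists>n\<ge>n0. card (B (Suc n)) \<le> m"
    using liminf_card_bounded_frequently[OF assms(3)] by blast
  then have "\<exists>\<Lambda>\<subseteq>\<int>. is_spectrum (cantor_moran_measure N B) \<Lambda>"
    by (rule integer_spectrum_exists)
  with real_distribution_cantor_moran show ?thesis
    by (auto simp: spectral_measure_def)
qed

end
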